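(* Consider the public good provision problem described in the context: the designer chooses a mechanism $(\alpha,t)$ to maximize $\mathbb E\big[\alpha(s)\big(\sum_i v_i(s)-c\big)\big]$ subject to ex-ante budget balance, ex-post IC and ex-post IR. Then there exists an optimal mechanism that is a two-threshold policy. Moreover, if the agents are symmetric and the signals $(s_1,\dots,s_n)$ follow an exchangeable distribution, then there exists an optimal two-threshold policy that is symmetric (i.e. whose allocation rule $\alpha$ is invariant under permutations of $(s_1,\dots,s_n)$).
   Context: There are $n$ agents. Agent $i$ observes a private signal $s_i\in S_i$, where $S_i\subset\mathbb R$ is a compact interval. The signal profile $s=(s_1,\dots,s_n)$ has a joint distribution (possibly correlated) with a positive continuous density $g$ on $S_1\times\cdots\times S_n$. Agent $i$'s value for the project is $v_i(s_i,s_{-i})$, which is bounded, continuously differentiable, and (strictly) increasing in $s_i$ for almost all $s_{-i}$. If the project is implemented with probability $\alpha$ and $i$ pays $t_i$, $i$'s ex-post payoff is $\alpha v_i(s_i,s_{-i})-t_i$. The cost of the project is $c\in\mathbb R$. A mechanism is a (measurable) map $(\alpha,t):S_1\times\cdots\times S_n\to[0,1]\times\mathbb R^n$. Constraints: ex-ante budget balance: $\mathbb E[\sum_i t_i(s)]\ge\mathbb E[c\,\alpha(s)]$. Ex-post IC: for all $i$, $s_i,\hat s_i,s_{-i}$, $\alpha(s)v_i(s)-t_i(s)\ge\alpha(\hat s_i,s_{-i})v_i(s_i,s_{-i})-t_i(\hat s_i,s_{-i})$. Ex-post IR: for all $i$ and $s$, $\alpha(s)v_i(s)-t_i(s)\ge0$.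 A mechanism $(\alpha,t)$ is a two-threshold policy if there exist a monotone (nondecreasing in the component-wise order) function $\phi:S_1\times\cdots\times S_n\to[0,1]$ and constants $p,k_L,k_H\in[0,1]$ with $k_L\le k_H$ such that $\alpha(s)=1$ if $\phi(s)\ge k_H$, $\alpha(s)=p$ if $k_L\le\phi(s)<k_H$, and $\alpha(s)=0$ otherwise. The agents are symmetric if for any permutation $\pi$ of $\{1,\dots,n\}$ and any agent $i$, $v_i(s_{\pi(1)},\dots,s_{\pi(n)})=v_{\pi(i)}(s_1,\dots,s_n)$. *)

theory Defs
  imports "HOL-Probability.Probability" "HOL-Combinatorics.Permutations"
begin

text \<open>
  The agents are the elements of a finite type \<open>'n\<close>. Agent \<open>i\<close>'s signal space is the
  interval \<open>{lo $ i .. hi $ i}\<close>; since the order on \<open>real ^ 'n\<close> is componentwise, the set of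
  signal profiles is the order interval \<open>{lo..hi}\<close>. The functions \<open>g\<close> (density), \<open>v i\<close>
  (values), \<open>\<alpha>\<close> (allocation) and \<open>t\<close> (transfers) matter only on that set.
\<close>

definition signal_dist :: "real ^ 'n \<Rightarrow> real ^ 'n \<Rightarrow> (real ^ 'n \<Rightarrow> real) \<Rightarrow> (real ^ 'n) measure" where
  "signal_dist lo hi g = density (restrict_space lborel {lo..hi}) (\<lambda>s. ennreal (g s))"

text \<open>The profile \<open>(x, s\<^sub>-\<^sub>i)\<close>.\<close>

definition deviate :: "real ^ 'n \<Rightarrow> 'n \<Rightarrow> real \<Rightarrow> real ^ 'n" where
  "deviate s i x = (\<chi> j. if j = i then x else s $ j)"

definition C1_on :: "(real ^ 'n) set \<Rightarrow> (real ^ 'n \<Rightarrow> real) \<Rightarrow> bool" where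
  "C1_on S f \<longleftrightarrow> (\<exists>Df :: real ^ 'n \<Rightarrow> real ^ 'n. continuous_on S Df \<and>
     (\<forall>s\<in>S. (f has_derivative (\<lambda>h. Df s \<bullet> h)) (at s within S)))"

text \<open>
  The property under the almost-everywhere quantifier depends on \<open>s\<^sub>-\<^sub>i\<close> only, so it holds
  for almost all \<open>s\<close> iff it holds for almost all \<open>s\<^sub>-\<^sub>i\<close>.
\<close>

definition increasing_in_own_signal ::
    "real ^ 'n \<Rightarrow> real ^ 'n \<Rightarrow> (real ^ 'n \<Rightarrow> real) \<Rightarrow> ('n \<Rightarrow> real ^ 'n \<Rightarrow> real) \<Rightarrow> bool" where
  "increasing_in_own_signal lo hi g v \<longleftrightarrow>
     (\<forall>i. AE s in signal_dist lo hi g.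
        strict_mono_on {lo $ i .. hi $ i} (\<lambda>x. v i (deviate s i x)))"

definition mechanism ::
    "real ^ 'n \<Rightarrow> real ^ 'n \<Rightarrow> (real ^ 'n \<Rightarrow> real) \<Rightarrow> (real ^ 'n \<Rightarrow> real ^ 'n) \<Rightarrow> bool" where
  "mechanism lo hi \<alpha> t \<longleftrightarrow>
     \<alpha> \<in> borel_measurable (restrict_space borel {lo..hi}) \<and>
     t \<in> borel_measurable (restrict_space borel {lo..hi}) \<and>
     (\<forall>s\<in>{lo..hi}. 0 \<le> \<alpha> s \<and> \<alpha> s \<le> 1)"

text \<open>
  Integrability of the total transfer has to be required explicitly because the Bochner
  integral of a non-integrable function is \<open>0\<close>. Under ex-post IR the transfers are bounded
  above, so a non-integrable total transfer has expectation \<open>-\<infinity>\<close> and violates the constraint.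
\<close>

definition budget_balanced ::
    "real ^ 'n \<Rightarrow> real ^ 'n \<Rightarrow> (real ^ 'n \<Rightarrow> real) \<Rightarrow> real \<Rightarrow>
     (real ^ 'n \<Rightarrow> real) \<Rightarrow> (real ^ 'n \<Rightarrow> real ^ 'n) \<Rightarrow> bool" where
  "budget_balanced lo hi g c \<alpha> t \<longleftrightarrow>
     integrable (signal_dist lo hi g) (\<lambda>s. \<Sum>i\<in>UNIV. t s $ i) \<and>
     (\<integral>s. (\<Sum>i\<in>UNIV. t s $ i) \<partial>signal_dist lo hi g) \<ge> (\<integral>s. c * \<alpha> s \<partial>signal_dist lo hi g)"

definition ex_post_IC ::
    "real ^ 'n \<Rightarrow> real ^ 'n \<Rightarrow> ('n \<Rightarrow> real ^ 'n \<Rightarrow> real) \<Rightarrow>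
     (real ^ 'n \<Rightarrow> real) \<Rightarrow> (real ^ 'n \<Rightarrow> real ^ 'n) \<Rightarrow> bool" where
  "ex_post_IC lo hi v \<alpha> t \<longleftrightarrow>
     (\<forall>i. \<forall>s\<in>{lo..hi}. \<forall>x\<in>{lo $ i .. hi $ i}.
        \<alpha> s * v i s - t s $ i \<ge> \<alpha> (deviate s i x) * v i s - t (deviate s i x) $ i)"

definition ex_post_IR ::
    "real ^ 'n \<Rightarrow> real ^ 'n \<Rightarrow> ('n \<Rightarrow> real ^ 'n \<Rightarrow> real) \<Rightarrow>
     (real ^ 'n \<Rightarrow> real) \<Rightarrow> (real ^ 'n \<Rightarrow> real ^ 'n) \<Rightarrow> bool" where
  "ex_post_IR lo hi v \<alpha> t \<longleftrightarrow> (\<forall>i. \<forall>s\<in>{lo..hi}. \<alpha> s * v i s - t s $ i \<ge> 0)"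

definition feasible ::
    "real ^ 'n \<Rightarrow> real ^ 'n \<Rightarrow> (real ^ 'n \<Rightarrow> real) \<Rightarrow> ('n \<Rightarrow> real ^ 'n \<Rightarrow> real) \<Rightarrow> real \<Rightarrow>
     (real ^ 'n \<Rightarrow> real) \<Rightarrow> (real ^ 'n \<Rightarrow> real ^ 'n) \<Rightarrow> bool" where
  "feasible lo hi g v c \<alpha> t \<longleftrightarrow>
     mechanism lo hi \<alpha> t \<and> budget_balanced lo hi g c \<alpha> t \<and>
     ex_post_IC lo hi v \<alpha> t \<and> ex_post_IR lo hi v \<alpha> t"

definition welfare ::
    "real ^ 'n \<Rightarrow> real ^ 'n \<Rightarrow> (real ^ 'n \<Rightarrow> real) \<Rightarrow> ('n \<Rightarrow> real ^ 'n \<Rightarrow> real) \<Rightarrow> real \<Rightarrow>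
     (real ^ 'n \<Rightarrow> real) \<Rightarrow> real" where
  "welfare lo hi g v c \<alpha> = (\<integral>s. \<alpha> s * ((\<Sum>i\<in>UNIV. v i s) - c) \<partial>signal_dist lo hi g)"

definition optimal ::
    "real ^ 'n \<Rightarrow> real ^ 'n \<Rightarrow> (real ^ 'n \<Rightarrow> real) \<Rightarrow> ('n \<Rightarrow> real ^ 'n \<Rightarrow> real) \<Rightarrow> real \<Rightarrow>
     (real ^ 'n \<Rightarrow> real) \<Rightarrow> (real ^ 'n \<Rightarrow> real ^ 'n) \<Rightarrow> bool" where
  "optimal lo hi g v c \<alpha> t \<longleftrightarrow> feasible lo hi g v c \<alpha> t \<and>
     (\<forall>\<alpha>' t'. feasible lo hi g v c \<alpha>' t' \<longrightarrow> welfare lo hi g v c \<alpha>' \<le> welfare lo hi g v c \<alpha>)"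

definition two_threshold :: "real ^ 'n \<Rightarrow> real ^ 'n \<Rightarrow> (real ^ 'n \<Rightarrow> real) \<Rightarrow> bool" where
  "two_threshold lo hi \<alpha> \<longleftrightarrow>
     (\<exists>(\<phi> :: real ^ 'n \<Rightarrow> real) p kL kH.
        mono_on {lo..hi} \<phi> \<and> \<phi> ` {lo..hi} \<subseteq> {0..1} \<and>
        p \<in> {0..1} \<and> kL \<in> {0..1} \<and> kH \<in> {0..1} \<and> kL \<le> kH \<and>
        (\<forall>s\<in>{lo..hi}. \<alpha> s = (if \<phi> s \<ge> kH then 1 else if \<phi> s \<ge> kL then p else 0)))"

definition permute_profile :: "('n \<Rightarrow> 'n) \<Rightarrow> real ^ 'n \<Rightarrow> real ^ 'n" where
  "permute_profile \<pi> s = (\<chi> i. s $ \<pi> i)"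

text \<open>
  For \<open>v i (permute_profile \<pi> s)\<close> to be meaningful the signal spaces must coincide, which is
  the first conjunct below; it also follows from exchangeability of the signals.
\<close>

definition symmetric_agents ::
    "real ^ 'n \<Rightarrow> real ^ 'n \<Rightarrow> ('n \<Rightarrow> real ^ 'n \<Rightarrow> real) \<Rightarrow> bool" where
  "symmetric_agents lo hi v \<longleftrightarrow>
     (\<forall>i j. {lo $ i .. hi $ i} = {lo $ j .. hi $ j}) \<and>
     (\<forall>\<pi>. \<pi> permutes UNIV \<longrightarrow>
        (\<forall>i. \<forall>s\<in>{lo..hi}. v i (permute_profile \<pi> s) = v (\<pi> i) s))"

definition exchangeable :: "real ^ 'n \<Rightarrow> real ^ 'n \<Rightarrow> (real ^ 'n \<Rightarrow> real) \<Rightarrow> bool" where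
  "exchangeable lo hi g \<longleftrightarrow>
     (\<forall>\<pi>. \<pi> permutes UNIV \<longrightarrow>
        distr (signal_dist lo hi g) borel (permute_profile \<pi>) =
        distr (signal_dist lo hi g) borel (\<lambda>s. s))"

definition symmetric_allocation :: "real ^ 'n \<Rightarrow> real ^ 'n \<Rightarrow> (real ^ 'n \<Rightarrow> real) \<Rightarrow> bool" where
  "symmetric_allocation lo hi \<alpha> \<longleftrightarrow>
     (\<forall>\<pi>. \<pi> permutes UNIV \<longrightarrow> (\<forall>s\<in>{lo..hi}. \<alpha> (permute_profile \<pi> s) = \<alpha> s))"

end

theory Submission
  imports Defs
begin

text \<open>
  By the envelope formula, ex-post IC and IR bound the expected transfers of an allocation
  \<open>\<alpha>\<close> by a linear functional of \<open>\<alpha>\<close>, and a monotone \<open>\<alpha>\<close> attains the bound. So the problem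
  is to maximize one linear functional over monotone \<open>[0,1]\<close>-valued functions subject to
  the nonnegativity of another. A maximizer \<open>\<alpha>\<close> exists because the class is convex and closed
  under pointwise limsup. Being the mean over \<open>u\<close> of the indicators of its level sets
  \<open>{\<alpha> > u}\<close>, it can be replaced by a mixture of only two of these indicators that does
  at least as well; as level sets are nested, the mixture is a two-threshold policy with
  \<open>\<phi>\<close> the mixture itself. In the symmetric case, averaging over permutations
  shows that nothing is lost by restricting the maximization to symmetric \<open>\<alpha>\<close>.

  Feasible allocations are monotone only along almost every line parallel to an axis; averaging
  over small cubes yields an everywhere monotone version.
\<close>

text \<open>Two level sets suffice because only two numbers per level set matter, its welfare and
  its expected budget surplus: the pair belonging to \<alpha> is the mean of the curve traced by the
  levels, and under a single linear constraint some chord of a curve does as well as its mean. The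
  obstacle is that values are strictly increasing only for almost all profiles of the others.
  Incentive constraints force monotonicity only on almost every line, and transfers are bounded only
  there. That is enough for inequalities between integrals, but the mechanism exhibited must satisfy
  IC and IR at every profile. The gap closes because the derivative in the own signal is continuous,
  hence nonnegative everywhere, and because passing to a monotone version changes no
  integral.\<close>

section \<open>Replacing a mean by two points under one linear constraint\<close>

text \<open>If every mixture with nonnegative \<open>b\<close> fell short of the mean of
  \<open>a\<close>, integrating the resulting strict inequality for pairs with b(y) < 0 \<le> b(x)
  over y and then over x would contradict the two means. No closure is taken, so the two points are
  genuine elements of the space.\<close>

lemma (in prob_space) two_point_dominance:
  fixes a b :: "'a \<Rightarrow> real"
  assumes a: "integrable M a" and b: "integrable M b" and b_nonneg: "0 \<le> (\<integral>x. b x \<partial>M)"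
  obtains x y l where "x \<in> space M" "y \<in> space M" "0 \<le> l" "l \<le> 1"
    "0 \<le> l * b x + (1 - l) * b y" "(\<integral>x. a x \<partial>M) \<le> l * a x + (1 - l) * a y"
proof (rule ccontr)
  assume "\<not> thesis"
  then have no: "\<And>x y l. x \<in> space M \<Longrightarrow> y \<in> space M \<Longrightarrow> 0 \<le> l \<Longrightarrow> l \<le> 1 \<Longrightarrow>
      0 \<le> l * b x + (1 - l) * b y \<Longrightarrow> l * a x + (1 - l) * a y < (\<integral>x. a x \<partial>M)"
    using that by force
  define d where "d x = a x - (\<integral>x. a x \<partial>M)" for x
  have d: "integrable M d" unfolding d_def using a by simp
  have d0: "(\<integral>x. d x \<partial>M) = 0" unfolding d_def using a by (simp add: prob_space)
  have [measurable]: "a \<in> borel_measurable M" "b \<in> borel_measurable M" "d \<in> borel_measurable M"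
    using a b d by auto
  define P where "P x = (indicator {x. 0 \<le> b x} x :: real)" for x
  define N where "N x = (indicator {x. b x < 0} x :: real)" for x
  have PN: "P x + N x = 1" for x by (auto simp: P_def N_def indicator_def)
  have [measurable]: "P \<in> borel_measurable M" "N \<in> borel_measurable M"
    unfolding P_def[abs_def] N_def[abs_def] by measurable
  have int: "integrable M (\<lambda>x. f x * P x)" "integrable M (\<lambda>x. f x * N x)" if "integrable M f" for f
    by (rule Bochner_Integration.integrable_bound[OF that]; (use that in measurable)?;
        simp add: P_def N_def indicator_def)+
  have split: "(\<integral>x. f x * P x \<partial>M) + (\<integral>x. f x * N x \<partial>M) = (\<integral>x. f x \<partial>M)" if "integrable M f" for f
    by (subst Bochner_Integration.integral_add[symmetric])
       (auto simp: int that distrib_left[symmetric] PN)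
  define dN where "dN = (\<integral>x. d x * N x \<partial>M)"
  define bN where "bN = (\<integral>x. b x * N x \<partial>M)"
  have d_neg: "d x < 0" if "x \<in> space M" "0 \<le> b x" for x
    using no[of x x 1] that by (simp add: d_def)
  have cross: "b x * d y - b y * d x < 0" if "x \<in> space M" "y \<in> space M" "0 \<le> b x" "b y < 0" for x y
  proof -
    \<comment> \<open>The weight at which the mixture of \<open>b x\<close> and \<open>b y\<close>
      is exactly zero.\<close>
    define l where "l = - b y / (b x - b y)"
    have l: "0 \<le> l" "l \<le> 1" "1 - l = b x / (b x - b y)"
      using that by (auto simp: l_def field_simps)
    have "l * b x + (1 - l) * b y = 0" unfolding l(3) using that by (simp add: l_def field_simps)
    from no[OF that(1,2) l(1,2)] this have "l * a x + (1 - l) * a y < (\<integral>x. a x \<partial>M)" by simp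
    then have "l * d x + (1 - l) * d y < 0" by (simp add: d_def algebra_simps)
    then have "(l * d x + (1 - l) * d y) * (b x - b y) < 0"
      using that by (intro mult_neg_pos) auto
    moreover have "l * (b x - b y) = - b y" "(1 - l) * (b x - b y) = b x"
      unfolding l(3) using that by (simp_all add: l_def)
    then have "(l * d x + (1 - l) * d y) * (b x - b y) = b x * d y - b y * d x"
      by (metis (no_types, opaque_lifting) add.commute distrib_right minus_mult_left mult.assoc
          mult.commute uminus_add_conv_diff)
    ultimately show ?thesis by simp
  qed
  have nonpos: "(\<integral>x. f x \<partial>M) \<le> 0" if "\<And>x. x \<in> space M \<Longrightarrow> f x \<le> 0" for f :: "'a \<Rightarrow> real"
    using Bochner_Integration.integral_nonneg[of M "\<lambda>x. - f x"] that by simp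
  have zero: "AE x in M. f x = 0"
    if "integrable M f" "\<And>x. x \<in> space M \<Longrightarrow> f x \<le> 0" "0 \<le> (\<integral>x. f x \<partial>M)" for f :: "'a \<Rightarrow> real"
  proof -
    have "(\<integral>x. f x \<partial>M) \<le> 0" using that by (intro nonpos) auto
    then have "(\<integral>x. - f x \<partial>M) = 0" using that by simp
    then have "AE x in M. - f x = 0"
      by (subst (asm) integral_nonneg_eq_0_iff_AE) (use that in auto)
    then show ?thesis by simp
  qed
  have N_pos: "\<not> (AE x in M. N x = 0)"
  proof
    assume "AE x in M. N x = 0"
    then have ae: "AE x in M. d x < 0"
      using AE_space by eventually_elim (auto simp: N_def indicator_def intro: d_neg split: if_splits)
    have "AE x in M. min (d x) 0 = 0"
    proof (rule zero)
      have "(\<integral>x. min (d x) 0 \<partial>M) = (\<integral>x. d x \<partial>M)"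
        by (rule integral_cong_AE) (use ae in auto)
      then show "0 \<le> (\<integral>x. min (d x) 0 \<partial>M)" using d0 by simp
    qed (use d in auto)
    with ae have "AE x in M. False" by eventually_elim auto
    then show False by simp
  qed
  have P_pos: "\<not> (AE x in M. P x = 0)"
  proof
    assume "AE x in M. P x = 0"
    then have ae: "AE x in M. b x < 0"
      by eventually_elim (auto simp: P_def indicator_def split: if_splits)
    have "AE x in M. min (b x) 0 = 0"
    proof (rule zero)
      have "(\<integral>x. min (b x) 0 \<partial>M) = (\<integral>x. b x \<partial>M)"
        by (rule integral_cong_AE) (use ae in auto)
      then show "0 \<le> (\<integral>x. min (b x) 0 \<partial>M)" using b_nonneg by simp
    qed (use b in auto)
    with ae have "AE x in M. False" by eventually_elim auto
    then show False by simp
  qed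
  \<comment> \<open>First integration, over the y with \<open>b y < 0\<close>; strictness survives
    because this set is not null (\<open>N_pos\<close>).\<close>
  have fix_x: "b x * dN - bN * d x < 0" if x: "x \<in> space M" "0 \<le> b x" for x
  proof (rule ccontr)
    assume "\<not> ?thesis"
    moreover have eq: "b x * dN - bN * d x = (\<integral>y. b x * (d y * N y) - (b y * N y) * d x \<partial>M)"
      unfolding dN_def bN_def using int[OF d] int[OF b]
      by (subst Bochner_Integration.integral_diff) auto
    ultimately have "AE y in M. b x * (d y * N y) - (b y * N y) * d x = 0"
      by (intro zero) (use int[OF d] int[OF b] cross[OF x(1) _ x(2)] in
           \<open>auto simp: N_def indicator_def less_imp_le\<close>)
    then have "AE y in M. N y = 0"
      using AE_space by eventually_elim (use cross[OF x(1) _ x(2)] in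
           \<open>force simp: N_def indicator_def\<close>)
    with N_pos show False ..
  qed
  \<comment> \<open>Second integration, over the x with b(x) \<ge> 0. Since \<open>d\<close> has
    mean zero, the outcome is the mean of \<open>b\<close> times \<open>dN\<close>, and both factors
    are nonnegative.\<close>
  have dP: "(\<integral>x. d x * P x \<partial>M) = - dN" using split[OF d] d0 by (simp add: dN_def)
  have bP: "(\<integral>x. b x * P x \<partial>M) \<ge> - bN" using split[OF b] b_nonneg by (simp add: bN_def)
  have "(\<integral>x. d x * P x \<partial>M) \<le> 0"
    by (intro nonpos) (auto simp: P_def indicator_def less_imp_le d_neg)
  then have dN_nonneg: "0 \<le> dN" using dP by simp
  have "(\<integral>x. (b x * P x) * dN - bN * (d x * P x) \<partial>M) = (\<integral>x. b x * P x \<partial>M) * dN + bN * dN"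
    using int[OF d] int[OF b] dP by (subst Bochner_Integration.integral_diff) auto
  also have "\<dots> = ((\<integral>x. b x * P x \<partial>M) + bN) * dN" by (simp add: algebra_simps)
  also have "\<dots> \<ge> 0" using bP dN_nonneg by simp
  finally have "AE x in M. (b x * P x) * dN - bN * (d x * P x) = 0"
    by (intro zero) (use int[OF d] int[OF b] fix_x in \<open>auto simp: P_def indicator_def less_imp_le\<close>)
  then have "AE x in M. P x = 0"
    using AE_space by eventually_elim (use fix_x in \<open>force simp: P_def indicator_def\<close>)
  with P_pos show False ..
qed

subsection \<open>Monotone allocations\<close>

text \<open>\<open>G\<close> collects the maps under which an allocation must be invariant: none for
  the general statement, the coordinate permutations for symmetric agents. One existence proof thus
  serves both.\<close>

definition monotone_allocations :: "'a::order measure \<Rightarrow> ('a \<Rightarrow> 'a) set \<Rightarrow> ('a \<Rightarrow> real) set" where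
  "monotone_allocations M G = {\<alpha> \<in> borel_measurable M. mono_on (space M) \<alpha> \<and>
     \<alpha> ` space M \<subseteq> {0..1} \<and> (\<forall>\<pi>\<in>G. \<forall>s\<in>space M. \<alpha> (\<pi> s) = \<alpha> s)}"

lemma monotone_allocationsD:
  assumes "\<alpha> \<in> monotone_allocations M G"
  shows "\<alpha> \<in> borel_measurable M" "mono_on (space M) \<alpha>"
    "\<And>s. s \<in> space M \<Longrightarrow> 0 \<le> \<alpha> s" "\<And>s. s \<in> space M \<Longrightarrow> \<alpha> s \<le> 1"
    "\<And>\<pi> s. \<pi> \<in> G \<Longrightarrow> s \<in> space M \<Longrightarrow> \<alpha> (\<pi> s) = \<alpha> s"
  using assms unfolding monotone_allocations_def by auto

lemma monotone_allocationsI: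
  assumes "\<alpha> \<in> borel_measurable M" "mono_on (space M) \<alpha>"
    "\<And>s. s \<in> space M \<Longrightarrow> 0 \<le> \<alpha> s" "\<And>s. s \<in> space M \<Longrightarrow> \<alpha> s \<le> 1"
    "\<And>\<pi> s. \<pi> \<in> G \<Longrightarrow> s \<in> space M \<Longrightarrow> \<alpha> (\<pi> s) = \<alpha> s"
  shows "\<alpha> \<in> monotone_allocations M G"
  using assms unfolding monotone_allocations_def by auto

lemma monotone_allocations_convex:
  assumes a: "\<alpha> \<in> monotone_allocations M G" and b: "\<beta> \<in> monotone_allocations M G"
    and l: "0 \<le> l" "l \<le> 1"
  shows "(\<lambda>s. l * \<alpha> s + (1 - l) * \<beta> s) \<in> monotone_allocations M G"
proof (rule monotone_allocationsI)
  note A = monotone_allocationsD[OF a] and B = monotone_allocationsD[OF b]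
  show "(\<lambda>s. l * \<alpha> s + (1 - l) * \<beta> s) \<in> borel_measurable M" using A(1) B(1) by simp
  show "mono_on (space M) (\<lambda>s. l * \<alpha> s + (1 - l) * \<beta> s)"
    using A(2) B(2) l by (auto intro!: mono_onI add_mono mult_left_mono dest: mono_onD)
  fix s assume s: "s \<in> space M"
  show "0 \<le> l * \<alpha> s + (1 - l) * \<beta> s" using A(3) B(3) l s by simp
  show "l * \<alpha> s + (1 - l) * \<beta> s \<le> 1" using A(4)[OF s] B(4)[OF s] l by (intro convex_bound_le) auto
qed (use monotone_allocationsD(5)[OF a] monotone_allocationsD(5)[OF b] in auto)

lemma monotone_allocations_level:
  assumes a: "\<alpha> \<in> monotone_allocations M G"
  shows "(\<lambda>s. of_bool (u < \<alpha> s)) \<in> monotone_allocations M G"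
proof (rule monotone_allocationsI)
  note A = monotone_allocationsD[OF a]
  note [measurable] = A(1)
  show "(\<lambda>s. of_bool (u < \<alpha> s)) \<in> borel_measurable M" by measurable
  show "mono_on (space M) (\<lambda>s. of_bool (u < \<alpha> s) :: real)"
  proof (rule mono_onI)
    fix r s assume "r \<in> space M" "s \<in> space M" "r \<le> s"
    with mono_onD[OF A(2)] have "\<alpha> r \<le> \<alpha> s" .
    then show "(of_bool (u < \<alpha> r) :: real) \<le> of_bool (u < \<alpha> s)" by auto
  qed
qed (use monotone_allocationsD(5)[OF a] in auto)

text \<open>A limsup is defined at every profile, so monotonicity, bounds and invariance hold for it
  even where the sequence diverges. It is formed in \<open>ereal\<close> and is finite by the
  bounds.\<close>

lemma monotone_allocations_limsup:
  assumes a: "\<And>k :: nat. A k \<in> monotone_allocations M G"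
  shows "(\<lambda>s. real_of_ereal (limsup (\<lambda>k. ereal (A k s)))) \<in> monotone_allocations M G"
proof (rule monotone_allocationsI)
  note A = monotone_allocationsD[OF a]
  note [measurable] = A(1)
  have lo: "0 \<le> limsup (\<lambda>k. ereal (A k s))" if "s \<in> space M" for s
    by (rule le_Limsup) (use A(3)[OF that] in auto)
  have hi: "limsup (\<lambda>k. ereal (A k s)) \<le> 1" if "s \<in> space M" for s
    by (rule Limsup_bounded) (use A(4)[OF that] in auto)
  show "(\<lambda>s. real_of_ereal (limsup (\<lambda>k. ereal (A k s)))) \<in> borel_measurable M" by measurable
  show "mono_on (space M) (\<lambda>s. real_of_ereal (limsup (\<lambda>k. ereal (A k s))))"
  proof (rule mono_onI)
    fix r s assume rs: "r \<in> space M" "s \<in> space M" "r \<le> s"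
    have "limsup (\<lambda>k. ereal (A k r)) \<le> limsup (\<lambda>k. ereal (A k s))"
      by (rule Limsup_mono) (use mono_onD[OF A(2) rs] in auto)
    moreover have "limsup (\<lambda>k. ereal (A k s)) \<noteq> \<infinity>" using hi[OF rs(2)] by auto
    moreover have "limsup (\<lambda>k. ereal (A k r)) \<noteq> - \<infinity>" using lo[OF rs(1)] by auto
    ultimately show "real_of_ereal (limsup (\<lambda>k. ereal (A k r))) \<le> real_of_ereal (limsup (\<lambda>k. ereal (A k s)))"
      using lo[OF rs(1)] by (intro real_of_ereal_positive_mono) auto
  qed
  fix s assume s: "s \<in> space M"
  show "0 \<le> real_of_ereal (limsup (\<lambda>k. ereal (A k s)))" using lo[OF s] by (rule real_of_ereal_pos)
  show "real_of_ereal (limsup (\<lambda>k. ereal (A k s))) \<le> 1"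
    using lo[OF s] hi[OF s] by (cases "limsup (\<lambda>k. ereal (A k s))") (auto simp: one_ereal_def)
qed (use monotone_allocationsD(5)[OF a] in auto)

section \<open>Existence of a maximizer\<close>

lemma integrable_allocation_mult:
  fixes w :: "'a \<Rightarrow> real"
  assumes [measurable]: "\<alpha> \<in> borel_measurable M" and w: "integrable M w"
    and b: "\<And>s. s \<in> space M \<Longrightarrow> 0 \<le> \<alpha> s" "\<And>s. s \<in> space M \<Longrightarrow> \<alpha> s \<le> 1"
  shows "integrable M (\<lambda>s. \<alpha> s * w s)"
proof (rule Bochner_Integration.integrable_bound[OF w])
  have [measurable]: "w \<in> borel_measurable M" using w by auto
  show "(\<lambda>s. \<alpha> s * w s) \<in> borel_measurable M" by measurable
  show "AE s in M. norm (\<alpha> s * w s) \<le> norm (w s)"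
    by (rule AE_I2) (use b in \<open>auto simp: abs_mult intro!: mult_left_le_one_le\<close>)
qed

lemma integral_allocation_convex:
  fixes w :: "'a \<Rightarrow> real"
  assumes "integrable M (\<lambda>s. \<alpha> s * w s)" "integrable M (\<lambda>s. \<beta> s * w s)"
  shows "(\<integral>s. (l * \<alpha> s + (1 - l) * \<beta> s) * w s \<partial>M)
    = l * (\<integral>s. \<alpha> s * w s \<partial>M) + (1 - l) * (\<integral>s. \<beta> s * w s \<partial>M)"
proof -
  have "(\<integral>s. (l * \<alpha> s + (1 - l) * \<beta> s) * w s \<partial>M)
    = (\<integral>s. l * (\<alpha> s * w s) + (1 - l) * (\<beta> s * w s) \<partial>M)"
    by (simp add: algebra_simps)
  then show ?thesis using assms by simp
qed

text \<open>Where the subsequence is Cauchy its limsup is its limit, and dominated convergence with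
  majorant |w| handles every integrable weight \<open>w\<close>.\<close>

lemma monotone_allocations_compact:
  fixes A :: "nat \<Rightarrow> 'a::order \<Rightarrow> real"
  assumes A: "\<And>k. A k \<in> monotone_allocations M G"
    and conv: "strict_mono r" "AE s in M. Cauchy (\<lambda>k. A (r k) s)"
  obtains \<alpha> where "\<alpha> \<in> monotone_allocations M G"
    "\<And>w. integrable M w \<Longrightarrow> (\<lambda>k. \<integral>s. A (r k) s * w s \<partial>M) \<longlonglongrightarrow> (\<integral>s. \<alpha> s * w s \<partial>M)"
proof
  define \<alpha> where "\<alpha> = (\<lambda>s. real_of_ereal (limsup (\<lambda>k. ereal (A (r k) s))))"
  show \<alpha>: "\<alpha> \<in> monotone_allocations M G" unfolding \<alpha>_def using A by (rule monotone_allocations_limsup)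
  note [measurable] = monotone_allocationsD(1)[OF A] monotone_allocationsD(1)[OF \<alpha>]
  have lim: "AE s in M. (\<lambda>k. A (r k) s) \<longlonglongrightarrow> \<alpha> s"
    using conv(2)
  proof eventually_elim
    case (elim s)
    then obtain L where L: "(\<lambda>k. A (r k) s) \<longlonglongrightarrow> L" by (auto simp: Cauchy_convergent_iff convergent_def)
    then have "(\<lambda>k. ereal (A (r k) s)) \<longlonglongrightarrow> ereal L" by simp
    then have "limsup (\<lambda>k. ereal (A (r k) s)) = ereal L" by (intro lim_imp_Limsup) auto
    with L show ?case by (simp add: \<alpha>_def)
  qed
  fix w :: "'a \<Rightarrow> real" assume w: "integrable M w"
  have [measurable]: "w \<in> borel_measurable M" using w by auto
  show "(\<lambda>k. \<integral>s. A (r k) s * w s \<partial>M) \<longlonglongrightarrow> (\<integral>s. \<alpha> s * w s \<partial>M)"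
  proof (rule integral_dominated_convergence[where w="\<lambda>s. norm (w s)"])
    show "AE s in M. (\<lambda>k. A (r k) s * w s) \<longlonglongrightarrow> \<alpha> s * w s"
      using lim by eventually_elim (rule tendsto_mult_right)
    show "AE s in M. norm (A (r k) s * w s) \<le> norm (w s)" for k
      by (rule AE_I2) (use monotone_allocationsD(3,4)[OF A] in
        \<open>auto simp: abs_mult intro!: mult_left_le_one_le\<close>)
  qed (use w in auto)
qed

text \<open>
  The argument for the projection onto a convex set in a Hilbert space: elements of
  decreasing convex sets whose \<open>L\<^sup>2\<close> norm is nearly minimal form a Cauchy sequence by the
  parallelogram law.
\<close>

lemma (in prob_space) near_minimal_norm_Cauchy:
  fixes D :: "nat \<Rightarrow> ('a \<Rightarrow> real) set"
  assumes D_dec: "\<And>m k. m \<le> k \<Longrightarrow> D k \<subseteq> D m" and D_ne: "\<And>m. D m \<noteq> {}"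
    and D_mid: "\<And>m \<alpha> \<beta>. \<alpha> \<in> D m \<Longrightarrow> \<beta> \<in> D m \<Longrightarrow> (\<lambda>s. 1/2 * \<alpha> s + 1/2 * \<beta> s) \<in> D m"
    and D_meas: "\<And>m \<alpha>. \<alpha> \<in> D m \<Longrightarrow> \<alpha> \<in> borel_measurable M"
    and D_bd: "\<And>m \<alpha> s. \<alpha> \<in> D m \<Longrightarrow> s \<in> space M \<Longrightarrow> \<bar>\<alpha> s\<bar> \<le> 1"
  obtains A r where "\<And>k. A k \<in> D k" "strict_mono r" "AE s in M. Cauchy (\<lambda>k. A (r k :: nat) s)"
proof -
  define N where "N \<alpha> = (\<integral>s. (\<alpha> s)\<^sup>2 \<partial>M)" for \<alpha> :: "'a \<Rightarrow> real"
  have bdd_int: "integrable M f" if "f \<in> borel_measurable M" "\<And>s. s \<in> space M \<Longrightarrow> \<bar>f s\<bar> \<le> C"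
    for f :: "'a \<Rightarrow> real" and C
    by (rule integrable_const_bound[where B=C]) (use that in auto)
  have sq_bd: "(\<alpha> s)\<^sup>2 \<le> 1" if "\<alpha> \<in> D m" "s \<in> space M" for \<alpha> m s
    using D_bd[OF that] by (simp add: abs_le_square_iff[of _ 1, simplified])
  have sq_int: "integrable M (\<lambda>s. (\<alpha> s)\<^sup>2)" if "\<alpha> \<in> D m" for \<alpha> m
    by (rule bdd_int[of _ 1]) (use D_meas[OF that] sq_bd[OF that] in auto)
  have N_nonneg: "0 \<le> N \<alpha>" for \<alpha> unfolding N_def by simp
  have N_le: "N \<alpha> \<le> 1" if "\<alpha> \<in> D m" for \<alpha> m
    unfolding N_def using sq_bd[OF that] sq_int[OF that] by (intro integral_le_const) auto
  \<comment> \<open>The least squared norms rise as the sets shrink and stay below 1, so they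
    converge; the norms of nearly minimal elements then cluster at a single value.\<close>
  define d where "d m = Inf (N ` D m)" for m
  have bdd: "bdd_below (N ` D m)" for m using N_nonneg by (auto intro!: bdd_belowI2)
  have d_le: "d m \<le> N \<alpha>" if "\<alpha> \<in> D m" for m \<alpha>
    unfolding d_def using that bdd by (auto intro: cInf_lower)
  have d_mono: "mono d"
    unfolding d_def using D_dec D_ne bdd by (auto intro!: monoI cInf_superset_mono image_mono)
  have d_le_1: "d m \<le> 1" for m using D_ne[of m] d_le N_le by (meson ex_in_conv order_trans)
  obtain L where L: "d \<longlonglongrightarrow> L" "\<And>m. d m \<le> L"
    using incseq_convergent[of d 1] d_mono d_le_1 by (auto simp: mono_def incseq_def)
  have "\<exists>\<alpha>\<in>D m. N \<alpha> < d m + 1 / Suc m" for m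
  proof -
    have "Inf (N ` D m) < d m + 1 / Suc m" unfolding d_def by simp
    then show ?thesis using D_ne[of m] bdd[of m] by (subst (asm) cInf_less_iff) auto
  qed
  then obtain A where A: "\<And>m. A m \<in> D m" "\<And>m. N (A m) < d m + 1 / Suc m" by metis
  have [measurable]: "A m \<in> borel_measurable M" for m using D_meas[OF A(1)] .
  have A_int: "integrable M (A m)" for m by (rule bdd_int[OF D_meas[OF A(1)] D_bd[OF A(1)]])
  have diff_bd: "\<bar>A i s - A j s\<bar> \<le> 2" if "s \<in> space M" for i j s
    using D_bd[OF A(1) that, of i] D_bd[OF A(1) that, of j] by linarith
  have diff_int: "integrable M (\<lambda>s. A i s - A j s)" for i j using A_int by simp
  have diff_sq_int: "integrable M (\<lambda>s. (A i s - A j s)\<^sup>2)" for i j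
  proof (rule bdd_int[of _ 4])
    fix s assume "s \<in> space M"
    from diff_bd[OF this, of i j] show "\<bar>(A i s - A j s)\<^sup>2\<bar> \<le> 4"
      using abs_le_square_iff[of "A i s - A j s" 2] by simp
  qed measurable
  have parallelogram: "(\<integral>s. (A i s - A j s)\<^sup>2 \<partial>M) \<le> 4 * (L - d m + 1 / Suc m)"
    if "m \<le> i" "m \<le> j" for i j m
  proof -
    have Dm: "A i \<in> D m" "A j \<in> D m" using A(1) D_dec that by blast+
    let ?a = "\<lambda>s. 1/2 * A i s + 1/2 * A j s"
    \<comment> \<open>The midpoint lies in \<open>D m\<close>, so its squared norm is at least
      \<open>d m\<close>: the lower bound needed in the parallelogram identity.\<close>
    have a: "?a \<in> D m" by (rule D_mid[OF Dm])
    have "(\<integral>s. (A i s - A j s)\<^sup>2 \<partial>M)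
        = (\<integral>s. 2 * (A i s)\<^sup>2 + 2 * (A j s)\<^sup>2 - 4 * (?a s)\<^sup>2 \<partial>M)"
      by (rule Bochner_Integration.integral_cong) (auto simp: power2_eq_square algebra_simps)
    also have "\<dots> = 2 * N (A i) + 2 * N (A j) - 4 * N ?a"
      unfolding N_def using sq_int[OF A(1)] sq_int[OF a]
      by (subst Bochner_Integration.integral_diff Bochner_Integration.integral_add;
          (intro Bochner_Integration.integrable_add integrable_mult_right)?; simp)+
    finally have eq: "(\<integral>s. (A i s - A j s)\<^sup>2 \<partial>M) = 2 * N (A i) + 2 * N (A j) - 4 * N ?a" .
    have "N (A k) \<le> L + 1 / Suc m" if "m \<le> k" for k
    proof -
      have "1 / Suc k \<le> 1 / Suc m" using that by (simp add: frac_le)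
      then show ?thesis using A(2)[of k] L(2)[of k] by linarith
    qed
    from this[OF that(1)] this[OF that(2)] d_le[OF a] eq show ?thesis by (simp add: algebra_simps)
  qed
  have small: "\<exists>N. \<forall>i\<ge>N. \<forall>j\<ge>N. (\<integral>s. norm (A i s - A j s) \<partial>M) < e" if e: "0 < e" for e
  proof -
    have "(\<lambda>m. 4 * (L - d m + 1 / Suc m)) \<longlonglongrightarrow> 4 * (L - L + 0)"
      by (intro tendsto_intros L(1) LIMSEQ_Suc[OF lim_1_over_n])
    then have "(\<lambda>m. 4 * (L - d m + 1 / Suc m)) \<longlonglongrightarrow> 0" by simp
    from order_tendstoD(2)[OF this, of "e\<^sup>2"] e
    obtain m where m: "4 * (L - d m + 1 / Suc m) < e\<^sup>2" by (auto simp: eventually_sequentially)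
    show ?thesis
    proof (intro exI allI impI)
      fix i j assume "m \<le> i" "m \<le> j"
      note lt = le_less_trans[OF parallelogram[OF this] m]
      \<comment> \<open>The bound 2 e x \<le> e^2 + x^2 takes the place of Cauchy-Schwarz in passing
        from L2 to L1.\<close>
      have "2 * e * (\<integral>s. norm (A i s - A j s) \<partial>M) = (\<integral>s. 2 * e * norm (A i s - A j s) \<partial>M)" by simp
      also have "\<dots> \<le> (\<integral>s. e\<^sup>2 + (A i s - A j s)\<^sup>2 \<partial>M)"
      proof (rule integral_mono)
        show "2 * e * norm (A i s - A j s) \<le> e\<^sup>2 + (A i s - A j s)\<^sup>2" for s
          using sum_squares_bound[of e "\<bar>A i s - A j s\<bar>"] by simp
      qed (use diff_int diff_sq_int in auto)
      also have "\<dots> = e\<^sup>2 + (\<integral>s. (A i s - A j s)\<^sup>2 \<partial>M)" using diff_sq_int by (simp add: prob_space)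
      also have "\<dots> < 2 * e * e" using lt by (simp add: power2_eq_square)
      finally show "(\<integral>s. norm (A i s - A j s) \<partial>M) < e" using e by simp
    qed
  qed
  show thesis
    by (rule cauchy_L1_AE_cauchy_subseq[OF A_int small]) (use that A(1) in auto)
qed

text \<open>The nearly optimal feasible allocations form decreasing nonempty convex sets, so a
  maximizing sequence can be chosen with a subsequence that converges almost everywhere, and both
  functionals pass to the limit. Over a general order an arbitrary maximizing sequence need not have
  such a subsequence.\<close>

lemma exists_optimal_allocation:
  fixes w b :: "'a::order \<Rightarrow> real"
  assumes "prob_space M" and w: "integrable M w" and b: "integrable M b"
  obtains \<alpha> where "\<alpha> \<in> monotone_allocations M G" "0 \<le> (\<integral>s. \<alpha> s * b s \<partial>M)"
    "\<forall>\<beta>\<in>monotone_allocations M G. 0 \<le> (\<integral>s. \<beta> s * b s \<partial>M) \<longrightarrow>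
       (\<integral>s. \<beta> s * w s \<partial>M) \<le> (\<integral>s. \<alpha> s * w s \<partial>M)"
proof -
  interpret prob_space M by fact
  define F where "F = {\<alpha> \<in> monotone_allocations M G. 0 \<le> (\<integral>s. \<alpha> s * b s \<partial>M)}"
  define W where "W \<alpha> = (\<integral>s. \<alpha> s * w s \<partial>M)" for \<alpha>
  have int: "integrable M (\<lambda>s. \<alpha> s * f s)" if "\<alpha> \<in> monotone_allocations M G" "integrable M f" for \<alpha> f
    using monotone_allocationsD[OF that(1)] that(2) by (intro integrable_allocation_mult) auto
  have "(\<lambda>s. 0) \<in> F" unfolding F_def by (auto intro!: monotone_allocationsI mono_onI)
  then have F_ne: "F \<noteq> {}" by auto
  have "W \<alpha> \<le> (\<integral>s. norm (w s) \<partial>M)" if "\<alpha> \<in> F" for \<alpha>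
    unfolding W_def
  proof (rule integral_mono)
    have \<alpha>: "\<alpha> \<in> monotone_allocations M G" using that by (auto simp: F_def)
    show "integrable M (\<lambda>s. \<alpha> s * w s)" by (rule int[OF \<alpha> w])
    fix s assume s: "s \<in> space M"
    have "\<alpha> s * w s \<le> \<alpha> s * \<bar>w s\<bar>" using monotone_allocationsD(3)[OF \<alpha> s] by (intro mult_left_mono) auto
    also have "\<dots> \<le> norm (w s)"
      using monotone_allocationsD(3,4)[OF \<alpha> s] by (auto intro!: mult_left_le_one_le)
    finally show "\<alpha> s * w s \<le> norm (w s)" .
  qed (use w in auto)
  then have bdd: "bdd_above (W ` F)" by (auto intro!: bdd_aboveI2)
  define V where "V = Sup (W ` F)"
  have W_le: "W \<alpha> \<le> V" if "\<alpha> \<in> F" for \<alpha> unfolding V_def using that bdd by (auto intro: cSup_upper)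
  define D where "D m = {\<alpha> \<in> F. V - 1 / Suc m \<le> W \<alpha>}" for m
  obtain A r where A: "\<And>k. A k \<in> D k" and r: "strict_mono r" "AE s in M. Cauchy (\<lambda>k. A (r k :: nat) s)"
  proof (rule near_minimal_norm_Cauchy[of D])
    show "D k \<subseteq> D m" if "m \<le> k" for m k
    proof -
      have "1 / Suc k \<le> 1 / Suc m" using that by (simp add: frac_le)
      then show ?thesis unfolding D_def by auto
    qed
    show "D m \<noteq> {}" for m
    proof -
      have "V - 1 / Suc m < Sup (W ` F)" unfolding V_def by simp
      then show ?thesis using F_ne bdd unfolding D_def by (subst (asm) less_cSup_iff) (auto intro: less_imp_le)
    qed
    fix m \<alpha> assume \<alpha>: "\<alpha> \<in> D m"
    then have \<alpha>': "\<alpha> \<in> monotone_allocations M G" by (auto simp: D_def F_def)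
    show "\<alpha> \<in> borel_measurable M" by (rule monotone_allocationsD(1)[OF \<alpha>'])
    show "\<bar>\<alpha> s\<bar> \<le> 1" if "s \<in> space M" for s using monotone_allocationsD(3,4)[OF \<alpha>' that] by simp
    fix \<beta> assume \<beta>: "\<beta> \<in> D m"
    then have \<beta>': "\<beta> \<in> monotone_allocations M G" by (auto simp: D_def F_def)
    show "(\<lambda>s. 1/2 * \<alpha> s + 1/2 * \<beta> s) \<in> D m"
      using \<alpha> \<beta> monotone_allocations_convex[OF \<alpha>' \<beta>', of "1/2"]
        integral_allocation_convex[OF int[OF \<alpha>' w] int[OF \<beta>' w], of "1/2"]
        integral_allocation_convex[OF int[OF \<alpha>' b] int[OF \<beta>' b], of "1/2"]
      by (simp add: D_def F_def W_def)
  next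
    fix A r assume "\<And>k. A k \<in> D k" "strict_mono r" "AE s in M. Cauchy (\<lambda>k. A (r k :: nat) s)"
    then show thesis by (rule that)
  qed
  have A': "A k \<in> monotone_allocations M G" "0 \<le> (\<integral>s. A k s * b s \<partial>M)" "V - 1 / Suc k \<le> W (A k)" for k
    using A[of k] by (auto simp: D_def F_def)
  obtain \<alpha> where \<alpha>: "\<alpha> \<in> monotone_allocations M G"
    and lim: "\<And>w. integrable M w \<Longrightarrow> (\<lambda>k. \<integral>s. A (r k) s * w s \<partial>M) \<longlonglongrightarrow> (\<integral>s. \<alpha> s * w s \<partial>M)"
    using monotone_allocations_compact[OF A'(1) r] by metis
  show thesis
  proof
    show "\<alpha> \<in> monotone_allocations M G" by fact
    show "0 \<le> (\<integral>s. \<alpha> s * b s \<partial>M)"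
      by (rule LIMSEQ_le_const[OF lim[OF b]]) (use A'(2) in auto)
    show "\<forall>\<beta>\<in>monotone_allocations M G. 0 \<le> (\<integral>s. \<beta> s * b s \<partial>M) \<longrightarrow>
       (\<integral>s. \<beta> s * w s \<partial>M) \<le> (\<integral>s. \<alpha> s * w s \<partial>M)"
    proof (intro ballI impI)
      fix \<beta> assume "\<beta> \<in> monotone_allocations M G" "0 \<le> (\<integral>s. \<beta> s * b s \<partial>M)"
      then have "W \<beta> \<le> V" by (intro W_le) (auto simp: F_def)
      also have "V \<le> W \<alpha>"
      proof (rule LIMSEQ_le)
        have "(\<lambda>k. V - 1 / Suc (r k)) \<longlonglongrightarrow> V - 0"
          by (intro tendsto_intros LIMSEQ_subseq_LIMSEQ[OF LIMSEQ_Suc[OF lim_1_over_n] r(1), unfolded o_def])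
        then show "(\<lambda>k. V - 1 / Suc (r k)) \<longlonglongrightarrow> V" by simp
        show "(\<lambda>k. W (A (r k))) \<longlonglongrightarrow> W \<alpha>" unfolding W_def by (rule lim[OF w])
      qed (use A'(3) in auto)
      finally show "(\<integral>s. \<beta> s * w s \<partial>M) \<le> (\<integral>s. \<alpha> s * w s \<partial>M)" unfolding W_def .
    qed
  qed
qed

section \<open>Level sets of an allocation\<close>

text \<open>Layer cake: \<open>\<alpha> s\<close> is the length of the set of levels u in [0,1) with
  u < \<open>\<alpha> s\<close>. Fubini applies because |w| dominates the integrand for every u, and
  the levels carry a probability measure.\<close>

lemma integral_level_sets:
  fixes w :: "'a \<Rightarrow> real"
  assumes "prob_space M" and [measurable]: "\<alpha> \<in> borel_measurable M" and w: "integrable M w"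
    and \<alpha>: "\<And>s. s \<in> space M \<Longrightarrow> 0 \<le> \<alpha> s" "\<And>s. s \<in> space M \<Longrightarrow> \<alpha> s \<le> 1"
  defines "U \<equiv> restrict_space lborel {0..<1::real}"
  shows "integrable U (\<lambda>u. \<integral>s. of_bool (u < \<alpha> s) * w s \<partial>M)"
    and "(\<integral>u. (\<integral>s. of_bool (u < \<alpha> s) * w s \<partial>M) \<partial>U) = (\<integral>s. \<alpha> s * w s \<partial>M)"
proof -
  interpret M: prob_space M by fact
  interpret U: prob_space U unfolding U_def by (rule prob_space_restrict_space) auto
  interpret pair_sigma_finite U M ..
  have [measurable]: "w \<in> borel_measurable M" using w by auto
  have [measurable]: "(\<lambda>u. u) \<in> borel_measurable U" unfolding U_def by (rule measurable_restrict_space1) simp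
  have le: "norm (of_bool P * w s) \<le> norm (w s)" for P s by (cases P) auto
  have joint: "integrable (U \<Otimes>\<^sub>M M) (\<lambda>(u, s). of_bool (u < \<alpha> s) * w s)"
  proof (rule Fubini_integrable)
    show "(\<lambda>(u, s). of_bool (u < \<alpha> s) * w s) \<in> borel_measurable (U \<Otimes>\<^sub>M M)" by measurable
    have sec: "integrable M (\<lambda>s. of_bool (u < \<alpha> s) * w s)" for u
      by (rule Bochner_Integration.integrable_bound[OF w]) (use le in auto)
    show "AE u in U. integrable M (\<lambda>s. case (u, s) of (u, s) \<Rightarrow> of_bool (u < \<alpha> s) * w s)"
      using sec by simp
    show "integrable U (\<lambda>u. \<integral>s. norm (case (u, s) of (u, s) \<Rightarrow> of_bool (u < \<alpha> s) * w s) \<partial>M)"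
    proof (rule U.integrable_const_bound[where B="\<integral>s. norm (w s) \<partial>M"])
      show "AE u in U. norm (\<integral>s. norm (case (u, s) of (u, s) \<Rightarrow> of_bool (u < \<alpha> s) * w s) \<partial>M)
          \<le> (\<integral>s. norm (w s) \<partial>M)"
        using sec w le by (auto intro!: AE_I2 integral_mono)
    qed simp
  qed
  show "integrable U (\<lambda>u. \<integral>s. of_bool (u < \<alpha> s) * w s \<partial>M)"
    using integrable_fst[OF joint] .
  have "(\<integral>u. (\<integral>s. of_bool (u < \<alpha> s) * w s \<partial>M) \<partial>U) = (\<integral>s. (\<integral>u. of_bool (u < \<alpha> s) * w s \<partial>U) \<partial>M)"
    using Fubini_integral[OF joint] by simp
  also have "\<dots> = (\<integral>s. \<alpha> s * w s \<partial>M)"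
  proof (rule Bochner_Integration.integral_cong)
    fix s assume s: "s \<in> space M"
    have "(\<integral>u. of_bool (u < \<alpha> s) * w s \<partial>U) = (\<integral>u. of_bool (u < \<alpha> s) \<partial>U) * w s" by simp
    also have "(\<integral>u. of_bool (u < \<alpha> s) \<partial>U) = (\<integral>u. indicat_real {0..<\<alpha> s} u \<partial>(lborel :: real measure))"
    proof -
      have "indicator {0..<1} u *\<^sub>R of_bool (u < \<alpha> s) = indicat_real {0..<\<alpha> s} u" for u
        using \<alpha>[OF s] by (auto simp: indicator_def)
      then show ?thesis unfolding U_def by (subst integral_restrict_space) simp_all
    qed
    also have "\<dots> = \<alpha> s" using \<alpha>[OF s] by simp
    finally show "(\<integral>u. of_bool (u < \<alpha> s) * w s \<partial>U) = \<alpha> s * w s" .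
  qed simp
  finally show "(\<integral>u. (\<integral>s. of_bool (u < \<alpha> s) * w s \<partial>M) \<partial>U) = (\<integral>s. \<alpha> s * w s \<partial>M)" .
qed

text \<open>This is \<open>two_point_dominance\<close> over the levels u, with the two functionals
  evaluated at the level set of u in the roles of \<open>a\<close> and \<open>b\<close>. Level sets
  inherit monotonicity and invariance, so the mixture stays in the class.\<close>

lemma exists_two_level_improvement:
  fixes w b :: "'a::order \<Rightarrow> real"
  assumes "prob_space M" and w: "integrable M w" and b: "integrable M b"
    and \<alpha>: "\<alpha> \<in> monotone_allocations M G" and "0 \<le> (\<integral>s. \<alpha> s * b s \<partial>M)"
  obtains \<beta> p where "\<beta> \<in> monotone_allocations M G" "0 \<le> (\<integral>s. \<beta> s * b s \<partial>M)"
    "(\<integral>s. \<alpha> s * w s \<partial>M) \<le> (\<integral>s. \<beta> s * w s \<partial>M)"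
    "0 \<le> p" "p \<le> 1" "\<forall>s. \<beta> s \<in> {0, p, 1}"
proof -
  interpret M: prob_space M by fact
  define U where "U = restrict_space lborel {0..<1::real}"
  interpret U: prob_space U unfolding U_def by (rule prob_space_restrict_space) auto
  note A = monotone_allocationsD[OF \<alpha>]
  define L where "L u s = (of_bool (u < \<alpha> s) :: real)" for u s
  have L: "L u \<in> monotone_allocations M G" for u
    unfolding L_def by (rule monotone_allocations_level[OF \<alpha>])
  have L_int: "integrable M (\<lambda>s. L u s * f s)" if "integrable M f" for u f
    using monotone_allocationsD[OF L] that by (intro integrable_allocation_mult) auto
  note lc = integral_level_sets[OF assms(1) A(1) _ A(3,4), folded U_def L_def]
  obtain u1 u2 l where l: "0 \<le> l" "l \<le> 1"
    and "0 \<le> l * (\<integral>s. L u1 s * b s \<partial>M) + (1 - l) * (\<integral>s. L u2 s * b s \<partial>M)"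
    and "(\<integral>u. (\<integral>s. L u s * w s \<partial>M) \<partial>U)
      \<le> l * (\<integral>s. L u1 s * w s \<partial>M) + (1 - l) * (\<integral>s. L u2 s * w s \<partial>M)"
    using lc(2)[OF b] assms(5)
    by (rule_tac U.two_point_dominance[OF lc(1)[OF w] lc(1)[OF b]]) auto
  then have "0 \<le> (\<integral>s. (l * L u1 s + (1 - l) * L u2 s) * b s \<partial>M)"
    "(\<integral>s. \<alpha> s * w s \<partial>M) \<le> (\<integral>s. (l * L u1 s + (1 - l) * L u2 s) * w s \<partial>M)"
    using lc(2)[OF w] by (simp_all add: integral_allocation_convex L_int w b)
  \<comment> \<open>The level set of the smaller u contains the other one, so besides 0 and 1 the
    mixture takes only the weight of the larger set.\<close>
  moreover have "l * L u1 s + (1 - l) * L u2 s \<in> {0, if u1 \<le> u2 then l else 1 - l, 1}" for s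
    unfolding L_def by auto
  ultimately show thesis
    using that[OF monotone_allocations_convex[OF L L l], of u1 u2 "if u1 \<le> u2 then l else 1 - l"] l
    by simp
qed

lemma two_threshold_if_two_levels:
  fixes \<alpha> :: "real ^ 'n \<Rightarrow> real"
  assumes "mono_on {lo..hi} \<alpha>" "0 \<le> p" "p \<le> 1" "\<And>s. s \<in> {lo..hi} \<Longrightarrow> \<alpha> s \<in> {0, p, 1}"
  shows "two_threshold lo hi \<alpha>"
  unfolding two_threshold_def
proof (intro exI conjI ballI)
  show "\<alpha> ` {lo..hi} \<subseteq> {0..1}" using assms by fastforce
  fix s assume "s \<in> {lo..hi}"
  \<comment> \<open>The thresholds are \<open>kL = p\<close> and \<open>kH = 1\<close>. For p = 0
    the middle branch returns 0 as well.\<close>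
  from assms(4)[OF this] show "\<alpha> s = (if 1 \<le> \<alpha> s then 1 else if p \<le> \<alpha> s then p else 0)"
    using assms(2,3) by auto
qed (use assms in auto)

subsection \<open>The envelope formula\<close>

text \<open>The information rent of type x over the lowest type l, where \<open>a\<close> is the
  allocation along the line of one agent and \<open>f'\<close> the derivative of that agent's
  value.\<close>

definition envelope_rent :: "(real \<Rightarrow> real) \<Rightarrow> (real \<Rightarrow> real) \<Rightarrow> real \<Rightarrow> real \<Rightarrow> real" where
  "envelope_rent a f' l x = (\<integral>y. indicator {l..x} y * (a y * f' y) \<partial>lborel)"

lemma derivative_Icc_integral:
  fixes f f' :: "real \<Rightarrow> real"
  assumes "\<forall>z\<in>{l..h}. (f has_real_derivative f' z) (at z within {l..h})"
    and cont: "continuous_on {l..h} f'" and yx: "l \<le> y" "y \<le> x" "x \<le> h"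
  shows "(\<integral>z. indicator {y..x} z * f' z \<partial>lborel) = f x - f y"
    and "integrable lborel (\<lambda>z. indicator {y..x} z * f' z)"
proof -
  have sub: "{y..x} \<subseteq> {l..h}" using yx by auto
  have c: "continuous_on {y..x} f'" by (rule continuous_on_subset[OF cont sub])
  have "(\<integral>z. indicator {y..x} z *\<^sub>R f' z \<partial>lborel) = f x - f y"
  proof (rule integral_FTC_Icc[OF yx(2) _ c])
    fix z assume "y \<le> z" "z \<le> x"
    then show "(f has_vector_derivative f' z) (at z within {y..x})"
      using bspec[OF assms(1), of z] sub
      by (auto simp: has_real_derivative_iff_has_vector_derivative
          intro: has_vector_derivative_within_subset)
  qed
  then show "(\<integral>z. indicator {y..x} z * f' z \<partial>lborel) = f x - f y" by simp
  show "integrable lborel (\<lambda>z. indicator {y..x} z * f' z)"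
    using borel_integrable_atLeastAtMost'[OF c] by (simp add: set_integrable_def)
qed

text \<open>As \<open>f'\<close> is nonnegative, replacing \<open>a\<close> on [y,x] by its least
  value \<open>a y\<close> or its greatest value \<open>a x\<close> bounds the integral from below
  or above.\<close>

lemma envelope_rent_increment:
  fixes a f f' :: "real \<Rightarrow> real"
  assumes f: "\<forall>z\<in>{l..h}. (f has_real_derivative f' z) (at z within {l..h})"
    and cont: "continuous_on {l..h} f'" and nonneg: "\<forall>z\<in>{l..h}. 0 \<le> f' z"
    and [measurable]: "(\<lambda>z. a z * f' z) \<in> borel_measurable borel"
    and a: "mono_on {l..h} a" "a ` {l..h} \<subseteq> {0..1}" and yx: "l \<le> y" "y \<le> x" "x \<le> h"
  shows "a y * (f x - f y) \<le> envelope_rent a f' l x - envelope_rent a f' l y"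
    and "envelope_rent a f' l x - envelope_rent a f' l y \<le> a x * (f x - f y)"
proof -
  note F = derivative_Icc_integral[OF f cont]
  have int: "integrable lborel (\<lambda>z. indicator {c..d} z * (a z * f' z))" if "l \<le> c" "c \<le> d" "d \<le> h" for c d
  proof (rule Bochner_Integration.integrable_bound[OF F(2)[OF that]])
    have "norm (indicator {c..d} z * (a z * f' z)) \<le> norm (indicator {c..d} z * f' z)" for z
    proof (cases "z \<in> {c..d}")
      case True
      with that have z: "z \<in> {l..h}" by auto
      then have "0 \<le> a z" "a z \<le> 1" using a(2) by (auto simp: image_subset_iff)
      then show ?thesis using bspec[OF nonneg z] True by (simp add: abs_mult mult_left_le_one_le)
    qed simp
    then show "AE z in lborel. norm (indicator {c..d} z * (a z * f' z)) \<le> norm (indicator {c..d} z * f' z)"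
      by simp
  qed measurable
  have "envelope_rent a f' l x = (\<integral>z. indicator {l..y} z * (a z * f' z) + indicator {y..x} z * (a z * f' z) \<partial>lborel)"
    unfolding envelope_rent_def
  proof (rule integral_cong_AE)
    show "AE z in lborel. indicator {l..x} z * (a z * f' z) = indicator {l..y} z * (a z * f' z) + indicator {y..x} z * (a z * f' z)"
      using AE_lborel_singleton[of y] by eventually_elim (use yx in \<open>auto simp: indicator_def\<close>)
  qed measurable
  also have "\<dots> = envelope_rent a f' l y + (\<integral>z. indicator {y..x} z * (a z * f' z) \<partial>lborel)"
    unfolding envelope_rent_def using yx by (intro Bochner_Integration.integral_add int) auto
  finally have eq: "envelope_rent a f' l x - envelope_rent a f' l y
    = (\<integral>z. indicator {y..x} z * (a z * f' z) \<partial>lborel)" by simp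
  have "a y * (f x - f y) = (\<integral>z. a y * (indicator {y..x} z * f' z) \<partial>lborel)" using F(1)[OF yx] by simp
  also have "\<dots> \<le> (\<integral>z. indicator {y..x} z * (a z * f' z) \<partial>lborel)"
  proof (rule integral_mono)
    show "a y * (indicator {y..x} z * f' z) \<le> indicator {y..x} z * (a z * f' z)" for z
      using mono_onD[OF a(1), of y z] bspec[OF nonneg, of z] yx by (auto simp: indicator_def intro!: mult_right_mono)
  qed (use F(2)[OF yx] int[OF yx] in auto)
  finally show "a y * (f x - f y) \<le> envelope_rent a f' l x - envelope_rent a f' l y" unfolding eq .
  have "(\<integral>z. indicator {y..x} z * (a z * f' z) \<partial>lborel) \<le> (\<integral>z. a x * (indicator {y..x} z * f' z) \<partial>lborel)"
  proof (rule integral_mono)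
    show "indicator {y..x} z * (a z * f' z) \<le> a x * (indicator {y..x} z * f' z)" for z
      using mono_onD[OF a(1), of z x] bspec[OF nonneg, of z] yx by (auto simp: indicator_def intro!: mult_right_mono)
  qed (use F(2)[OF yx] int[OF yx] in auto)
  also have "\<dots> = a x * (f x - f y)" using F(1)[OF yx] by simp
  finally show "envelope_rent a f' l x - envelope_rent a f' l y \<le> a x * (f x - f y)" unfolding eq .
qed

lemma envelope_rent_nonneg:
  assumes "\<forall>z\<in>{l..h}. 0 \<le> f' z" "a ` {l..h} \<subseteq> {0..1}" "x \<le> h"
  shows "0 \<le> envelope_rent a f' l x"
  unfolding envelope_rent_def
proof (rule Bochner_Integration.integral_nonneg)
  fix y
  show "0 \<le> indicator {l..x} y * (a y * f' y)"
    using bspec[OF assms(1), of y] assms(2,3) by (auto simp: indicator_def image_subset_iff)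
qed

lemma envelope_rent_start: "envelope_rent a f' l l = 0"
  unfolding envelope_rent_def
proof (rule integral_eq_zero_AE)
  show "AE y in lborel. indicator {l..l} y * (a y * f' y) = 0"
    using AE_lborel_singleton[of l] by eventually_elim auto
qed

text \<open>Incentive compatibility along one line: with the value \<open>f\<close> as coordinate,
  the rent has subgradient \<open>a y\<close> at y. The lower bound on increments serves x above y,
  the upper bound x below y.\<close>

lemma envelope_rent_subgradient:
  fixes a f f' :: "real \<Rightarrow> real"
  assumes f: "\<forall>z\<in>{l..h}. (f has_real_derivative f' z) (at z within {l..h})"
    and cont: "continuous_on {l..h} f'" and nonneg: "\<forall>z\<in>{l..h}. 0 \<le> f' z"
    and meas: "(\<lambda>z. a z * f' z) \<in> borel_measurable borel"
    and a: "mono_on {l..h} a" "a ` {l..h} \<subseteq> {0..1}" and xy: "x \<in> {l..h}" "y \<in> {l..h}"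
  shows "envelope_rent a f' l y + a y * (f x - f y) \<le> envelope_rent a f' l x"
proof (cases "y \<le> x")
  case True
  then show ?thesis using envelope_rent_increment(1)[OF f cont nonneg meas a, of y x] xy by simp
next
  case False
  then have "a y * (f y - f x) \<ge> envelope_rent a f' l y - envelope_rent a f' l x"
    using envelope_rent_increment(2)[OF f cont nonneg meas a, of x y] xy by simp
  then show ?thesis by (simp add: algebra_simps)
qed

text \<open>
  On a grid of mesh \<open>\<epsilon>\<close> the defect of \<open>u - envelope_rent\<close> on one cell is at most
  \<open>C \<epsilon>\<close> times the increment of \<open>a\<close>; these increments telescope to at most \<open>1\<close>.
\<close>

lemma envelope_rent_le:
  fixes a f f' u :: "real \<Rightarrow> real"
  assumes f: "\<forall>z\<in>{l..h}. (f has_real_derivative f' z) (at z within {l..h})"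
    and cont: "continuous_on {l..h} f'" and nonneg: "\<forall>z\<in>{l..h}. 0 \<le> f' z"
    and meas: "(\<lambda>z. a z * f' z) \<in> borel_measurable borel"
    and a: "mono_on {l..h} a" "a ` {l..h} \<subseteq> {0..1}"
    and sub: "\<And>x y. x \<in> {l..h} \<Longrightarrow> y \<in> {l..h} \<Longrightarrow> u y + a y * (f x - f y) \<le> u x"
    and u: "0 \<le> u l" and x: "x \<in> {l..h}"
  shows "envelope_rent a f' l x \<le> u x"
proof -
  define G where "G z = u z - envelope_rent a f' l z" for z
  have "bounded (f' ` {l..h})"
    by (intro compact_imp_bounded compact_continuous_image cont compact_Icc)
  then obtain C where C: "\<And>z. z \<in> {l..h} \<Longrightarrow> \<bar>f' z\<bar> \<le> C" unfolding bounded_iff by fastforce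
  with x have C0: "0 \<le> C" by fastforce
  have f_le: "f z - f y \<le> C * (z - y)" if "l \<le> y" "y \<le> z" "z \<le> h" for y z
  proof -
    have "f z - f y = (\<integral>t. indicator {y..z} t * f' t \<partial>lborel)"
      using derivative_Icc_integral(1)[OF f cont that] by simp
    also have "\<dots> \<le> (\<integral>t. indicator {y..z} t * C \<partial>lborel)"
    proof (rule integral_mono)
      show "integrable lborel (\<lambda>t. indicator {y..z} t * f' t)" by (rule derivative_Icc_integral(2)[OF f cont that])
      show "indicator {y..z} t * f' t \<le> indicator {y..z} t * C" for t
        using C[of t] that by (auto simp: indicator_def)
      show "integrable lborel (\<lambda>t. indicator {y..z} t * C)"
        by (intro integrable_mult_left integrable_real_indicator) (auto simp: emeasure_lborel_Icc_eq)
    qed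
    also have "\<dots> = C * (z - y)" using that by simp
    finally show ?thesis .
  qed
  have step: "G y - G z \<le> C * (z - y) * (a z - a y)" if "l \<le> y" "y \<le> z" "z \<le> h" for y z
  proof -
    have "a y \<le> a z" using mono_onD[OF a(1), of y z] that by simp
    \<comment> \<open>Over a cell, \<open>u\<close> grows at least at the rate of \<open>a\<close>
      at the left end, the rent at most at the rate of \<open>a\<close> at the right end.\<close>
    have "G y - G z \<le> (a z - a y) * (f z - f y)"
      using sub[of z y] envelope_rent_increment(2)[OF f cont nonneg meas a that] that
      unfolding G_def by (simp add: algebra_simps)
    also have "\<dots> \<le> (a z - a y) * (C * (z - y))"
      using f_le[OF that] \<open>a y \<le> a z\<close> by (intro mult_left_mono) auto
    finally show ?thesis by (simp add: mult_ac)
  qed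
  have "- G x \<le> C * (x - l) / real (Suc m)" for m
  proof -
    define e where "e = (x - l) / real (Suc m)"
    define t where "t k = l + real k * e" for k
    have e: "0 \<le> e" using x by (simp add: e_def)
    have t0: "t 0 = l" by (simp add: t_def)
    have tm: "t (Suc m) = x" unfolding t_def e_def by (simp del: of_nat_Suc)
    have t_mono: "t j \<le> t k" if "j \<le> k" for j k
      using that e by (auto simp: t_def intro!: mult_right_mono)
    have "G (t 0) - G (t k) \<le> C * e * (a (t k) - a (t 0))" if "k \<le> Suc m" for k
      using that
    proof (induction k)
      case (Suc k)
      have "t (Suc k) \<le> h" using t_mono[OF Suc.prems] tm x by auto
      then have "G (t k) - G (t (Suc k)) \<le> C * (t (Suc k) - t k) * (a (t (Suc k)) - a (t k))"
        using t_mono[of 0 k] t_mono[of k "Suc k"] t0 by (intro step) auto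
      also have "t (Suc k) - t k = e" by (simp add: t_def algebra_simps)
      finally show ?case using Suc by (simp add: algebra_simps)
    qed simp
    from this[of "Suc m"] have "G l - G x \<le> C * e * (a x - a l)" unfolding t0 tm by simp
    also have "\<dots> \<le> C * e * 1"
    proof (rule mult_left_mono)
      have "a x \<le> 1" "0 \<le> a l" using a(2) x by (auto simp: image_subset_iff)
      then show "a x - a l \<le> 1" by simp
    qed (use C0 e in simp)
    finally show ?thesis using u by (simp add: G_def envelope_rent_start e_def)
  qed
  moreover have "(\<lambda>m. C * (x - l) / real (Suc m)) \<longlonglongrightarrow> 0"
    by (rule LIMSEQ_Suc[OF lim_const_over_n])
  ultimately have "- G x \<le> 0" by (intro LIMSEQ_le_const) auto
  then show ?thesis by (simp add: G_def)
qed

subsection \<open>Unilateral deviations and Lebesgue measure\<close>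

lemma deviate_nth [simp]: "deviate s i x $ j = (if j = i then x else s $ j)"
  by (simp add: deviate_def)

lemma deviate_deviate [simp]: "deviate (deviate s i x) i y = deviate s i y"
  by (simp add: vec_eq_iff)

lemma deviate_self [simp]: "deviate s i (s $ i) = s"
  by (simp add: vec_eq_iff)

lemma deviate_in_box:
  "s \<in> {lo..hi} \<Longrightarrow> x \<in> {lo $ i..hi $ i} \<Longrightarrow> deviate s i x \<in> {lo..hi}"
  by (auto simp: less_eq_vec_def)

lemma mono_on_deviate:
  assumes "mono_on {lo..hi} f" "s \<in> {lo..hi}"
  shows "mono_on {lo $ i..hi $ i} (\<lambda>x. f (deviate s i x))"
proof (rule mono_onI)
  fix x y assume "x \<in> {lo $ i..hi $ i}" "y \<in> {lo $ i..hi $ i}" "x \<le> y"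
  then show "f (deviate s i x) \<le> f (deviate s i y)"
    by (intro mono_onD[OF assms(1)] deviate_in_box assms(2)) (auto simp: less_eq_vec_def)
qed

lemma deviate_eq_add_axis: "deviate s i x = deviate s i 0 + x *\<^sub>R axis i 1"
  by (simp add: vec_eq_iff axis_def)

lemma continuous_on_deviate [continuous_intros]:
  fixes f :: "'a::topological_space \<Rightarrow> real ^ 'n"
  assumes "continuous_on S f" "continuous_on S g"
  shows "continuous_on S (\<lambda>p. deviate (f p) i (g p))"
  unfolding deviate_def
proof (rule continuous_on_vec_lambda)
  fix j
  show "continuous_on S (\<lambda>p. if j = i then g p else f p $ j)"
    using assms by (cases "j = i") (auto intro: continuous_intros)
qed

lemma measurable_vec_nth [measurable (raw)]:
  fixes f :: "'a \<Rightarrow> real ^ 'n"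
  assumes "f \<in> borel_measurable M"
  shows "(\<lambda>p. f p $ i) \<in> borel_measurable M"
  by (rule measurable_compose[OF assms borel_measurable_continuous_onI]) (intro continuous_intros)

lemma measurable_deviate [measurable (raw)]:
  fixes f :: "'a \<Rightarrow> real ^ 'n"
  assumes [measurable]: "f \<in> borel_measurable M" "g \<in> borel_measurable M"
  shows "(\<lambda>p. deviate (f p) i (g p)) \<in> borel_measurable M"
proof -
  have "(\<lambda>q :: (real ^ 'n) \<times> real. deviate (fst q) i (snd q)) \<in> borel_measurable borel"
    by (intro borel_measurable_continuous_onI continuous_intros)
  then have "(\<lambda>p. (\<lambda>q. deviate (fst q) i (snd q)) (f p, g p)) \<in> borel_measurable M"
    by (rule measurable_compose_rev) (rule borel_measurable_Pair; measurable)
  then show ?thesis by simp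
qed

lemma prod_Basis_vec: "(\<Prod>b\<in>Basis. (x :: real ^ 'n) \<bullet> b) = (\<Prod>j\<in>UNIV. x $ j)"
proof -
  have B: "(Basis :: (real ^ 'n) set) = range (\<lambda>j. axis j 1)" by (auto simp: Basis_vec_def)
  have "inj (\<lambda>j :: 'n. axis j (1 :: real))" by (auto simp: inj_on_def axis_eq_axis)
  from prod.reindex[OF this, of "\<lambda>b. x \<bullet> b"] show ?thesis unfolding B by (simp add: inner_axis)
qed

lemma prod_Basis_vec_real:
  fixes x :: "(real ^ 'n) \<times> real"
  shows "(\<Prod>b\<in>Basis. x \<bullet> b) = (\<Prod>j\<in>UNIV. fst x $ j) * snd x"
proof -
  have "(\<Prod>b\<in>Basis. x \<bullet> b) = (\<Prod>b\<in>(\<lambda>u. (u, 0)) ` Basis. x \<bullet> b) * (\<Prod>b\<in>(\<lambda>u. (0, u)) ` Basis. x \<bullet> b)"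
    unfolding Basis_prod_def by (rule prod.union_disjoint) auto
  also have "\<dots> = (\<Prod>b\<in>Basis. fst x \<bullet> b) * snd x"
    by (subst (1 2) prod.reindex) (auto simp: inj_on_def inner_prod_def)
  finally show ?thesis by (simp add: prod_Basis_vec)
qed

text \<open>The map permutes the coordinates of an (n+1)-dimensional space, so it takes boxes to
  boxes of equal volume. It gives Fubini in a single coordinate without splitting
  \<open>real ^ 'n\<close> into a product.\<close>

lemma lborel_distr_exchange_coordinate:
  "distr (lborel \<Otimes>\<^sub>M lborel) (lborel \<Otimes>\<^sub>M lborel) (\<lambda>(s :: real ^ 'n, x). (deviate s i x, s $ i))
    = lborel \<Otimes>\<^sub>M lborel"
proof -
  define T where "T = (\<lambda>(s :: real ^ 'n, x :: real). (deviate s i x, s $ i))"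
  have T_eq: "T = (\<lambda>p. (deviate (fst p) i (snd p), fst p $ i))" by (auto simp: T_def)
  have "continuous_on UNIV T" unfolding T_eq by (intro continuous_intros)
  then have [measurable]: "T \<in> borel_measurable borel" by (rule borel_measurable_continuous_onI)
  have "lborel = distr lborel borel T"
  proof (rule lborel_eqI)
    fix l u :: "(real ^ 'n) \<times> real" assume le: "\<And>b. b \<in> Basis \<Longrightarrow> l \<bullet> b \<le> u \<bullet> b"
    obtain l1 a u1 b where lu: "l = (l1, a)" "u = (u1, b)" by (cases l, cases u) auto
    have in_Basis: "(axis j 1, 0) \<in> (Basis :: ((real ^ 'n) \<times> real) set)" "(0, 1) \<in> (Basis :: ((real ^ 'n) \<times> real) set)" for j
      by (auto simp: Basis_prod_def)
    have le': "l1 $ j \<le> u1 $ j" "a \<le> b" for j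
      using le[OF in_Basis(1), of j] le[OF in_Basis(2)] by (auto simp: lu inner_axis)
    \<comment> \<open>\<open>T\<close> is its own inverse, so the preimage of a box is its image,
      with corners \<open>T l\<close> and \<open>T u\<close>.\<close>
    have vim: "T -` box l u = box (T l) (T u)"
    proof -
      have "p \<in> box (l1', a') (u1', b') \<longleftrightarrow> (\<forall>j. l1' $ j < fst p $ j \<and> fst p $ j < u1' $ j) \<and> a' < snd p \<and> snd p < b'"
        for p :: "(real ^ 'n) \<times> real" and l1' u1' a' b'
      proof -
        have "p \<in> box (l1', a') (u1', b') \<longleftrightarrow> fst p \<in> box l1' u1' \<and> snd p \<in> box a' b'"
          by (cases p) (auto simp: mem_box Basis_prod_def ball_Un)
        then show ?thesis by (simp add: mem_box_cart)
      qed
      then show ?thesis unfolding lu T_def by (auto split: if_splits)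
    qed
    have le_T: "T l \<bullet> b \<le> T u \<bullet> b" if "b \<in> Basis" for b
      using that le' by (auto simp: T_def lu Basis_prod_def Basis_vec_def inner_axis)
    have "emeasure (distr lborel borel T) (box l u) = emeasure lborel (T -` box l u)"
      by (subst emeasure_distr) auto
    also have "\<dots> = ennreal (\<Prod>b\<in>Basis. (T u - T l) \<bullet> b)"
      unfolding vim by (rule emeasure_lborel_box) (rule le_T)
    also have "(\<Prod>b\<in>Basis. (T u - T l) \<bullet> b) = (\<Prod>b\<in>Basis. (u - l) \<bullet> b)"
      unfolding prod_Basis_vec_real lu T_def
    proof -
      have "(\<Prod>j\<in>UNIV - {i}. (deviate u1 i b - deviate l1 i a) $ j) = (\<Prod>j\<in>UNIV - {i}. (u1 - l1) $ j)"
        by (rule prod.cong) auto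
      then show "(\<Prod>j\<in>UNIV. fst ((case (u1, b) of (s, x) \<Rightarrow> (deviate s i x, s $ i)) - (case (l1, a) of (s, x) \<Rightarrow> (deviate s i x, s $ i))) $ j)
          * snd ((case (u1, b) of (s, x) \<Rightarrow> (deviate s i x, s $ i)) - (case (l1, a) of (s, x) \<Rightarrow> (deviate s i x, s $ i)))
        = (\<Prod>j\<in>UNIV. fst ((u1, b) - (l1, a)) $ j) * snd ((u1, b) - (l1, a))"
        by (subst (1 2) prod.remove[of UNIV i]) (simp_all del: minus_vec_def vector_minus_component, simp)
    qed
    finally show "emeasure (distr lborel borel T) (box l u) = ennreal (\<Prod>b\<in>Basis. (u - l) \<bullet> b)" .
  qed simp
  moreover have "distr lborel lborel T = distr lborel borel T" by (rule distr_cong) auto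
  ultimately show ?thesis unfolding T_def[symmetric] lborel_prod by simp
qed

text \<open>The i-th coordinate of the first argument and the second argument trade places, which
  reverses the order of integration over these two real variables.\<close>

lemma integral_exchange_coordinate:
  fixes f :: "real ^ 'n \<Rightarrow> real \<Rightarrow> real"
  assumes "integrable (lborel \<Otimes>\<^sub>M lborel) (\<lambda>(s, x). f s x)"
  shows "(\<integral>s. (\<integral>x. f (deviate s i x) (s $ i) \<partial>lborel) \<partial>lborel) = (\<integral>s. (\<integral>x. f s x \<partial>lborel) \<partial>lborel)"
    and "integrable (lborel \<Otimes>\<^sub>M lborel) (\<lambda>(s, x). f (deviate s i x) (s $ i))"
proof -
  let ?T = "\<lambda>(s :: real ^ 'n, x). (deviate s i x, s $ i)"
  have T: "?T \<in> lborel \<Otimes>\<^sub>M lborel \<rightarrow>\<^sub>M lborel \<Otimes>\<^sub>M lborel" by measurable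
  have eq: "(\<lambda>(s, x). f (deviate s i x) (s $ i)) = (\<lambda>p. (\<lambda>(s, x). f s x) (?T p))" by auto
  have meas: "(\<lambda>(s, x). f s x) \<in> borel_measurable (lborel \<Otimes>\<^sub>M lborel)"
    by (rule borel_measurable_integrable[OF assms])
  show int: "integrable (lborel \<Otimes>\<^sub>M lborel) (\<lambda>(s, x). f (deviate s i x) (s $ i))"
    unfolding eq by (rule integrable_distr[OF T]) (simp only: lborel_distr_exchange_coordinate assms)
  have "(\<integral>s. (\<integral>x. f (deviate s i x) (s $ i) \<partial>lborel) \<partial>lborel)
      = (\<integral>p. (\<lambda>(s, x). f (deviate s i x) (s $ i)) p \<partial>(lborel \<Otimes>\<^sub>M lborel))"
    using lborel_pair.integral_fst[OF int] by simp
  also have "\<dots> = (\<integral>p. (\<lambda>(s, x). f s x) (?T p) \<partial>(lborel \<Otimes>\<^sub>M lborel))" by (simp only: eq)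
  also have "\<dots> = (\<integral>p. (\<lambda>(s, x). f s x) p \<partial>distr (lborel \<Otimes>\<^sub>M lborel) (lborel \<Otimes>\<^sub>M lborel) ?T)"
    by (rule integral_distr[OF T meas, symmetric])
  also have "\<dots> = (\<integral>s. (\<integral>x. f s x \<partial>lborel) \<partial>lborel)"
    unfolding lborel_distr_exchange_coordinate using lborel_pair.integral_fst[OF assms] by simp
  finally show "(\<integral>s. (\<integral>x. f (deviate s i x) (s $ i) \<partial>lborel) \<partial>lborel) = (\<integral>s. (\<integral>x. f s x \<partial>lborel) \<partial>lborel)" .
qed

subsection \<open>Monotone versions of almost everywhere monotone functions\<close>

lemma AE_lborel_translate:
  fixes c :: "'a::euclidean_space"
  assumes "AE z in lborel. P z" and meas: "{z. P z} \<in> sets borel"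
  shows "AE y in lborel. P (c + y)"
proof -
  have "AE z in distr lborel borel ((+) c). P z" unfolding lborel_distr_plus by (rule assms(1))
  then show ?thesis by (subst (asm) AE_distr_iff) (use meas in auto)
qed

lemma lborel_integral_translate:
  fixes c :: "'a::euclidean_space" and f :: "'a \<Rightarrow> real"
  assumes [measurable]: "f \<in> borel_measurable borel"
  shows "(\<integral>y. f (c + y) \<partial>lborel) = (\<integral>z. f z \<partial>lborel)"
proof -
  have "(\<integral>z. f z \<partial>lborel) = (\<integral>z. f z \<partial>distr lborel borel ((+) c))" unfolding lborel_distr_plus ..
  also have "\<dots> = (\<integral>y. f (c + y) \<partial>lborel)" by (rule integral_distr) measurable
  finally show ?thesis by simp
qed

text \<open>The way from y to y + d moves one coordinate at a time; at each stage the exceptional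
  set is a translate of a null set.\<close>

lemma AE_increasing_translate:
  fixes E :: "real ^ 'n \<Rightarrow> real"
  assumes [measurable]: "E \<in> borel_measurable borel"
    and step: "\<And>i h. 0 \<le> h \<Longrightarrow> AE y in lborel. E y \<le> E (y + h *\<^sub>R axis i 1)"
    and d: "0 \<le> d"
  shows "AE y in lborel. E y \<le> E (y + d)"
proof -
  have "finite J \<Longrightarrow> AE y in lborel. E y \<le> E (y + (\<Sum>j\<in>J. d $ j *\<^sub>R axis j 1))" for J
  proof (induction J rule: finite_induct)
    case (insert i J)
    let ?c = "\<Sum>j\<in>J. d $ j *\<^sub>R axis j 1 :: real ^ 'n"
    have "0 \<le> d $ i" using d by (simp add: less_eq_vec_def)
    then have "AE y in lborel. E (?c + y) \<le> E (?c + y + d $ i *\<^sub>R axis i 1)"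
      by (intro AE_lborel_translate step) measurable
    with insert.IH show ?case
    proof eventually_elim
      case (elim y)
      then show ?case using insert.hyps by (simp add: algebra_simps)
    qed
  qed simp
  from this[of UNIV] show ?thesis by (simp add: basis_expansion scalar_mult_eq_scaleR[symmetric])
qed

text \<open>
  The means of a coordinatewise monotone function over cubes \<open>[s, s + \<epsilon>]\<close> are monotone in
  \<open>s\<close> everywhere and converge almost everywhere as \<open>\<epsilon>\<close> tends to \<open>0\<close>.
\<close>

lemma monotone_version_of_AE_increasing:
  fixes E :: "real ^ 'n \<Rightarrow> real"
  assumes [measurable]: "E \<in> borel_measurable borel"
    and E01: "\<And>y. 0 \<le> E y" "\<And>y. E y \<le> 1"
    and step: "\<And>i h. 0 \<le> h \<Longrightarrow> AE y in lborel. E y \<le> E (y + h *\<^sub>R axis i 1)"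
  obtains \<beta> where "\<beta> \<in> monotone_allocations borel {}" "AE s in lborel. \<beta> s = E s"
proof -
  define h where "h k = 1 / real (Suc k)" for k
  have h: "0 < h k" for k by (simp add: h_def)
  define Q where "Q k = (cbox 0 (h k *\<^sub>R One) :: (real ^ 'n) set)" for k
  define A where "A k s = (\<integral>y. indicator (Q k) y * E (s + y) \<partial>lborel) / h k ^ DIM(real ^ 'n)" for k s
  have [measurable]: "Q k \<in> sets borel" for k by (simp add: Q_def)
  have Q_measure: "measure lborel (Q k) = h k ^ DIM(real ^ 'n)" "emeasure lborel (Q k) < \<infinity>" for k
    using h[of k] by (auto simp: Q_def content_cbox_if measure_lborel_cbox_eq box_eq_empty inner_diff_left emeasure_lborel_cbox_eq)
  have ind_int: "integrable lborel (\<lambda>y. indicat_real (Q k) y)" for k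
    using Q_measure(2)[of k] by (intro integrable_real_indicator) auto
  have int: "integrable lborel (\<lambda>y. indicator (Q k) y * E (s + y))" for k s
    by (rule Bochner_Integration.integrable_bound[OF ind_int[of k]])
       (use E01 in \<open>auto simp: indicator_def intro!: AE_I2\<close>)
  have A_mono: "A k s \<le> A k s'" if "s \<le> s'" for k s s'
  proof -
    \<comment> \<open>An inequality valid almost everywhere becomes, after integration over the
      cube, one between the means at the given points s and s'.\<close>
    have "AE z in lborel. E z \<le> E (z + (s' - s))"
      by (rule AE_increasing_translate) (use step that in auto)
    then have "AE y in lborel. E (s + y) \<le> E (s + y + (s' - s))"
      by (rule AE_lborel_translate) measurable
    then have "AE y in lborel. indicator (Q k) y * E (s + y) \<le> indicator (Q k) y * E (s' + y)"
      by eventually_elim (auto simp: algebra_simps indicator_def)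
    then have "(\<integral>y. indicator (Q k) y * E (s + y) \<partial>lborel) \<le> (\<integral>y. indicator (Q k) y * E (s' + y) \<partial>lborel)"
      by (intro integral_mono_AE int)
    then show ?thesis unfolding A_def using h[of k] by (intro divide_right_mono) auto
  qed
  have A_mem: "A k \<in> monotone_allocations borel {}" for k
  proof (rule monotone_allocationsI)
    show "A k \<in> borel_measurable borel" unfolding A_def by measurable
    show "mono_on (space borel) (A k)" by (intro mono_onI A_mono)
    fix s
    show "0 \<le> A k s" unfolding A_def using E01 h[of k] by (intro divide_nonneg_nonneg Bochner_Integration.integral_nonneg) auto
    have "(\<integral>y. indicator (Q k) y * E (s + y) \<partial>lborel) \<le> (\<integral>y. indicator (Q k) y \<partial>lborel)"
      by (intro integral_mono int ind_int) (use E01 in \<open>auto simp: indicator_def\<close>)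
    then show "A k s \<le> 1" unfolding A_def using Q_measure(1)[of k] h[of k] by (simp add: divide_le_eq_1)
  qed auto
  have "set_integrable lborel (cbox a b) E" for a b
    unfolding set_integrable_def
    by (rule Bochner_Integration.integrable_bound[OF integrable_real_indicator, of "cbox a b"])
       (use E01 in \<open>auto simp: indicator_def emeasure_lborel_cbox_eq intro!: AE_I2\<close>)
  note cube = set_borel_integral_eq_integral[OF this]
  have A_eq: "A k s = integral (cbox s (s + h k *\<^sub>R One)) E /\<^sub>R h k ^ DIM(real ^ 'n)" for k s
  proof -
    have "integral (cbox s (s + h k *\<^sub>R One)) E = (\<integral>z. indicator (cbox s (s + h k *\<^sub>R One)) z * E z \<partial>lborel)"
      using cube(2)[of s "s + h k *\<^sub>R One"] by (simp add: set_lebesgue_integral_def)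
    also have "\<dots> = (\<integral>y. indicator (cbox s (s + h k *\<^sub>R One)) (s + y) * E (s + y) \<partial>lborel)"
      by (rule lborel_integral_translate[symmetric]) measurable
    also have "\<dots> = (\<integral>y. indicator (Q k) y * E (s + y) \<partial>lborel)"
    proof -
      have "indicat_real (cbox s (s + h k *\<^sub>R One)) (s + y) = indicator (Q k) y" for y
        by (auto simp: Q_def mem_box indicator_def inner_add_left)
      then show ?thesis by simp
    qed
    finally show ?thesis by (simp add: A_def divide_inverse mult.commute)
  qed
  \<comment> \<open>Lebesgue differentiation along cubes with corner x.\<close>
  obtain N where N: "negligible N" and conv: "\<And>x e. x \<notin> N \<Longrightarrow> 0 < e \<Longrightarrow> \<exists>d>0. \<forall>h. 0 < h \<and> h < d \<longrightarrow>
      norm (integral (cbox x (x + h *\<^sub>R One)) E /\<^sub>R h ^ DIM(real ^ 'n) - E x) < e"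
    using integrable_ccontinuous_explicit[of E] cube(1) by metis
  have lim: "(\<lambda>k. A k x) \<longlonglongrightarrow> E x" if "x \<notin> N" for x
  proof (rule LIMSEQ_I)
    fix e :: real assume "0 < e"
    from conv[OF that this] obtain d where d: "0 < d"
      "\<And>h. 0 < h \<Longrightarrow> h < d \<Longrightarrow> norm (integral (cbox x (x + h *\<^sub>R One)) E /\<^sub>R h ^ DIM(real ^ 'n) - E x) < e" by auto
    have "h \<longlonglongrightarrow> 0" unfolding h_def by (rule LIMSEQ_Suc[OF lim_1_over_n])
    from order_tendstoD(2)[OF this d(1)] obtain k0 where "\<And>k. k0 \<le> k \<Longrightarrow> h k < d"
      by (auto simp: eventually_sequentially)
    then show "\<exists>k0. \<forall>k\<ge>k0. norm (A k x - E x) < e" unfolding A_eq using d(2) h by blast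
  qed
  have "AE x in lborel. x \<notin> N"
    using AE_not_in[of N lebesgue] N by (simp add: negligible_iff_null_sets AE_completion_iff)
  \<comment> \<open>On the null set where the means may diverge, the limsup supplies monotone
    values.\<close>
  show thesis
  proof
    show "(\<lambda>s. real_of_ereal (limsup (\<lambda>k. ereal (A k s)))) \<in> monotone_allocations borel {}"
      by (rule monotone_allocations_limsup[OF A_mem])
    show "AE s in lborel. real_of_ereal (limsup (\<lambda>k. ereal (A k s))) = E s"
      using \<open>AE x in lborel. x \<notin> N\<close>
    proof eventually_elim
      case (elim s)
      then have "(\<lambda>k. ereal (A k s)) \<longlonglongrightarrow> ereal (E s)" using lim by simp
      then have "limsup (\<lambda>k. ereal (A k s)) = ereal (E s)" by (intro lim_imp_Limsup) auto
      then show ?case by simp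
    qed
  qed
qed

lemma monotone_version:
  fixes \<alpha> :: "real ^ 'n \<Rightarrow> real"
  assumes meas [measurable]: "\<alpha> \<in> borel_measurable borel"
    and \<alpha>01: "\<alpha> ` {lo..hi} \<subseteq> {0..1}"
    and mono: "\<And>i. AE s in lborel. s \<in> {lo..hi} \<longrightarrow> mono_on {lo $ i..hi $ i} (\<lambda>x. \<alpha> (deviate s i x))"
  obtains \<beta> where "\<beta> \<in> monotone_allocations borel {}" "AE s in lborel. s \<in> {lo..hi} \<longrightarrow> \<beta> s = \<alpha> s"
proof -
  \<comment> \<open>Translations need a function on the whole space that still increases
    coordinatewise across the boundary of the box: 1 beyond the box above \<open>lo\<close>, and 0
    where some coordinate is below \<open>lo\<close>.\<close>
  define E where "E s = (if s \<in> {lo..hi} then \<alpha> s else if lo \<le> s then 1 else 0)" for s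
  have [measurable]: "Measurable.pred borel (\<lambda>s :: real ^ 'n. lo \<le> s)"
    unfolding less_eq_vec_def by measurable
  have [measurable]: "{lo..hi} \<in> sets borel" by (simp add: interval_cbox_cart)
  have E_meas: "E \<in> borel_measurable borel" unfolding E_def by measurable
  have E01: "0 \<le> E y" "E y \<le> 1" for y using \<alpha>01 by (auto simp: E_def image_subset_iff)
  have step: "AE y in lborel. E y \<le> E (y + h *\<^sub>R axis i 1)" if "0 \<le> h" for h i
    using mono[of i]
  proof eventually_elim
    case (elim y)
    let ?z = "y + h *\<^sub>R axis i 1"
    have z: "?z = deviate y i (y $ i + h)" by (simp add: vec_eq_iff axis_def)
    have le: "y \<le> ?z" using that by (simp add: less_eq_vec_def axis_def)
    show ?case
    proof (cases "y \<in> {lo..hi} \<and> ?z \<in> {lo..hi}")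
      case True
      then have "lo $ i \<le> y $ i \<and> y $ i \<le> hi $ i" "lo $ i \<le> ?z $ i \<and> ?z $ i \<le> hi $ i"
        unfolding atLeastAtMost_iff less_eq_vec_def by blast+
      moreover have "?z $ i = y $ i + h" by (simp add: axis_def)
      ultimately have "y $ i \<in> {lo $ i..hi $ i}" "y $ i + h \<in> {lo $ i..hi $ i}" by simp_all
      then have "\<alpha> (deviate y i (y $ i)) \<le> \<alpha> (deviate y i (y $ i + h))"
        using elim True that by (intro mono_onD[of "{lo $ i..hi $ i}" "\<lambda>x. \<alpha> (deviate y i x)"]) auto
      then have "\<alpha> y \<le> \<alpha> ?z" unfolding z by simp
      then show ?thesis using True by (simp only: E_def if_True)
    next
      case False
      have lo: "lo \<le> ?z" if "lo \<le> y" using that le by (rule order_trans)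
      have hi: "y \<le> hi" if "?z \<le> hi" using le that by (rule order_trans)
      consider "\<not> lo \<le> y" | "lo \<le> y" "\<not> ?z \<le> hi" using False lo hi by fastforce
      then show ?thesis
      proof cases
        case 1
        then have "E y = 0" unfolding E_def by simp
        then show ?thesis using E01(1)[of ?z] by simp
      next
        case 2
        then have "E ?z = 1" unfolding E_def using lo by simp
        then show ?thesis using E01(2)[of y] by simp
      qed
    qed
  qed
  obtain \<beta> where "\<beta> \<in> monotone_allocations borel {}" "AE s in lborel. \<beta> s = E s"
    by (rule monotone_version_of_AE_increasing[OF E_meas E01]) (assumption | rule step | blast)+
  moreover from this(2) have "AE s in lborel. s \<in> {lo..hi} \<longrightarrow> \<beta> s = \<alpha> s"
    by eventually_elim (simp add: E_def)
  ultimately show thesis by (intro that)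
qed

subsection \<open>Incentive compatible transfers\<close>

locale public_good =
  fixes lo hi :: "real ^ 'n::finite"
    and g :: "real ^ 'n \<Rightarrow> real"
    and v :: "'n \<Rightarrow> real ^ 'n \<Rightarrow> real"
    and c :: real
  assumes intervals: "\<forall>i. lo $ i \<le> hi $ i"
    and g_continuous: "continuous_on {lo..hi} g"
    and g_positive: "\<forall>s\<in>{lo..hi}. g s > 0"
    and g_density: "prob_space (signal_dist lo hi g)"
    and v_C1: "\<forall>i. C1_on {lo..hi} (v i)"
    and v_increasing: "increasing_in_own_signal lo hi g v"
begin

abbreviation X where "X \<equiv> {lo..hi}"
abbreviation \<mu> where "\<mu> \<equiv> signal_dist lo hi g"

sublocale \<mu>: prob_space \<mu> by (rule g_density)

lemma X_borel [measurable]: "X \<in> sets borel"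
  by (simp add: interval_cbox_cart)

lemma X_compact: "compact X"
  by (simp add: interval_cbox_cart)

lemma space_\<mu> [simp]: "space \<mu> = X"
  by (simp add: signal_dist_def space_restrict_space)

lemma sets_\<mu> [measurable_cong]: "sets \<mu> = sets (restrict_space borel X)"
  unfolding signal_dist_def by (simp add: sets_restrict_space)

lemma borel_measurable_\<mu>_iff:
  fixes f :: "real ^ 'n \<Rightarrow> real"
  shows "f \<in> borel_measurable \<mu> \<longleftrightarrow> (\<lambda>s. indicator X s * f s) \<in> borel_measurable borel"
proof -
  have "f \<in> borel_measurable \<mu> \<longleftrightarrow> f \<in> borel_measurable (restrict_space borel X)"
    by (rule measurable_cong_sets[OF sets_\<mu> refl, THEN arg_cong2[where f="(\<in>)", OF refl]])
  also have "\<dots> \<longleftrightarrow> (\<lambda>s. indicator X s * f s) \<in> borel_measurable borel"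
    by (subst borel_measurable_restrict_space_iff) simp_all
  finally show ?thesis .
qed

lemma borel_measurable_\<mu>_continuous:
  "continuous_on X f \<Longrightarrow> f \<in> borel_measurable \<mu>"
  unfolding measurable_cong_sets[OF sets_\<mu> refl] by (rule borel_measurable_continuous_on_restrict)

definition gX where "gX s = indicator X s * g s"

lemma gX_measurable [measurable]: "gX \<in> borel_measurable borel"
  using borel_measurable_\<mu>_continuous[OF g_continuous] unfolding borel_measurable_\<mu>_iff gX_def .

lemma g_measurable_restrict: "g \<in> borel_measurable (restrict_space lborel X)"
  using borel_measurable_continuous_on_restrict[OF g_continuous]
  by (simp add: measurable_cong_sets[OF sets_restrict_space_cong[OF sets_lborel] refl])

lemma g_nonneg_restrict: "AE s in restrict_space lborel X. 0 \<le> g s"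
  using g_positive by (intro AE_I2) (auto simp: space_restrict_space less_imp_le)

lemma f_measurable_restrict:
  "f \<in> borel_measurable \<mu> \<Longrightarrow> f \<in> borel_measurable (restrict_space lborel X)"
  unfolding signal_dist_def by simp

lemma integral_\<mu>:
  fixes f :: "real ^ 'n \<Rightarrow> real"
  assumes "f \<in> borel_measurable \<mu>"
  shows "(\<integral>s. f s \<partial>\<mu>) = (\<integral>s. gX s * f s \<partial>lborel)"
    and "integrable \<mu> f \<longleftrightarrow> integrable lborel (\<lambda>s. gX s * f s)"
proof -
  note f = f_measurable_restrict[OF assms]
  show "(\<integral>s. f s \<partial>\<mu>) = (\<integral>s. gX s * f s \<partial>lborel)"
    unfolding signal_dist_def
    by (subst integral_density[OF f g_measurable_restrict g_nonneg_restrict],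
        subst integral_restrict_space) (simp_all add: gX_def mult.assoc)
  show "integrable \<mu> f \<longleftrightarrow> integrable lborel (\<lambda>s. gX s * f s)"
    unfolding signal_dist_def
    by (subst integrable_density[OF f g_measurable_restrict g_nonneg_restrict],
        subst integrable_restrict_space) (simp_all add: gX_def mult.assoc)
qed

text \<open>Positivity of \<open>g\<close> makes the null sets of the signal distribution those of
  Lebesgue measure in \<open>X\<close>, so almost-everywhere statements about signals can be
  combined with translations and Fubini.\<close>

lemma AE_\<mu>: "(AE s in \<mu>. P s) \<longleftrightarrow> (AE s in lborel. s \<in> X \<longrightarrow> P s)"
proof -
  have "(AE s in \<mu>. P s) \<longleftrightarrow> (AE s in restrict_space lborel X. 0 < ennreal (g s) \<longrightarrow> P s)"
    unfolding signal_dist_def using g_measurable_restrict by (subst AE_density) simp_all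
  also have "\<dots> \<longleftrightarrow> (AE s in lborel. s \<in> X \<longrightarrow> 0 < ennreal (g s) \<longrightarrow> P s)"
    by (subst AE_restrict_space_iff) simp_all
  also have "\<dots> \<longleftrightarrow> (AE s in lborel. s \<in> X \<longrightarrow> P s)"
    using g_positive by (intro AE_cong) auto
  finally show ?thesis .
qed

text \<open>A degenerate signal interval would make \<open>X\<close> Lebesgue null and the total
  mass zero instead of one. Nondegeneracy makes the open box dense in \<open>X\<close>.\<close>

lemma box_nonempty: "box lo hi \<noteq> {}"
proof
  assume "box lo hi = {}"
  then have "negligible X" by (simp add: interval_cbox_cart negligible_interval)
  then have "AE s in lborel. s \<notin> X"
    using AE_not_in[of X lebesgue] by (simp add: negligible_iff_null_sets AE_completion_iff)
  then have "AE s in lborel. s \<in> X \<longrightarrow> False" by eventually_elim blast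
  then have "AE s in \<mu>. False" unfolding AE_\<mu> .
  then show False by simp
qed

section \<open>Derivatives of the values in the own signal\<close>

definition Dv where
  "Dv i = (SOME Df. continuous_on X Df \<and>
     (\<forall>s\<in>X. (v i has_derivative (\<lambda>h. Df s \<bullet> h)) (at s within X)))"

lemma Dv: "continuous_on X (Dv i)" "\<forall>s\<in>X. (v i has_derivative (\<lambda>h. Dv i s \<bullet> h)) (at s within X)"
proof -
  have "\<exists>Df. continuous_on X Df \<and> (\<forall>s\<in>X. (v i has_derivative (\<lambda>h. Df s \<bullet> h)) (at s within X))"
    using v_C1 by (simp add: C1_on_def)
  from someI_ex[OF this]
  show "continuous_on X (Dv i)" "\<forall>s\<in>X. (v i has_derivative (\<lambda>h. Dv i s \<bullet> h)) (at s within X)"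
    unfolding Dv_def by blast+
qed

lemma v_continuous: "continuous_on X (v i)"
  using Dv(2)[of i] by (intro has_derivative_continuous_on) blast

text \<open>Cut off outside \<open>X\<close> so that products with an allocation vanish there:
  allocations are constrained only on \<open>X\<close>, while the rent integrals run over the whole
  space.\<close>

definition own_deriv where "own_deriv i s = indicator X s * Dv i s $ i"

lemma own_deriv_continuous: "continuous_on X (own_deriv i)"
proof -
  have "continuous_on X (\<lambda>s. Dv i s $ i)" by (intro continuous_intros Dv(1))
  then show ?thesis by (rule continuous_on_eq) (simp add: own_deriv_def)
qed

lemma own_deriv_measurable [measurable]: "own_deriv i \<in> borel_measurable borel"
proof -
  have "(\<lambda>s. Dv i s $ i) \<in> borel_measurable \<mu>"
    by (intro borel_measurable_\<mu>_continuous continuous_intros Dv(1))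
  then show ?thesis unfolding borel_measurable_\<mu>_iff own_deriv_def .
qed

lemma v_own_derivative:
  assumes s: "s \<in> X"
  shows "\<forall>x\<in>{lo $ i..hi $ i}. ((\<lambda>x. v i (deviate s i x)) has_real_derivative own_deriv i (deviate s i x))
    (at x within {lo $ i..hi $ i})"
proof
  fix x assume x: "x \<in> {lo $ i..hi $ i}"
  let ?I = "{lo $ i..hi $ i}"
  have sub: "deviate s i ` ?I \<subseteq> X" using deviate_in_box[OF s] by blast
  have "((\<lambda>x. deviate s i 0 + x *\<^sub>R axis i 1) has_derivative (\<lambda>h. h *\<^sub>R axis i 1)) (at x within ?I)"
    by (auto intro!: derivative_eq_intros)
  then have inner: "(deviate s i has_derivative (\<lambda>h. h *\<^sub>R axis i 1)) (at x within ?I)"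
    by (simp add: deviate_eq_add_axis[symmetric])
  have "(v i has_derivative (\<lambda>h. Dv i (deviate s i x) \<bullet> h)) (at (deviate s i x) within deviate s i ` ?I)"
    using Dv(2)[of i] deviate_in_box[OF s x] by (intro has_derivative_subset[OF _ sub]) blast
  from has_derivative_in_compose[OF inner this]
  have "((\<lambda>x. v i (deviate s i x)) has_derivative (\<lambda>h. own_deriv i (deviate s i x) * h)) (at x within ?I)"
    using deviate_in_box[OF s x] by (simp add: own_deriv_def inner_axis mult.commute)
  then show "((\<lambda>x. v i (deviate s i x)) has_real_derivative own_deriv i (deviate s i x)) (at x within ?I)"
    by (simp add: has_field_derivative_def)
qed

lemma AE_strict_mono:
  "AE s in lborel. s \<in> X \<longrightarrow> strict_mono_on {lo $ i..hi $ i} (\<lambda>x. v i (deviate s i x))"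
  using v_increasing unfolding increasing_in_own_signal_def AE_\<mu> by blast

text \<open>Monotonicity on almost every line gives the sign at almost every interior point. By
  continuity the interior points with negative derivative form an open set, and a null open set is
  empty; density of the interior covers the boundary. The sign is thus available even on lines where
  the values are not assumed strictly increasing.\<close>

lemma own_deriv_nonneg: "0 \<le> own_deriv i s"
proof (cases "s \<in> X")
  case True
  have ae: "AE s in lborel. s \<in> box lo hi \<longrightarrow> 0 \<le> own_deriv i s"
    using AE_strict_mono[of i]
  proof eventually_elim
    case (elim s)
    show ?case
    proof
      assume s: "s \<in> box lo hi"
      then have sX: "s \<in> X" using box_subset_cbox[of lo hi] by (auto simp: interval_cbox_cart)
      have si: "s $ i \<in> interior {lo $ i..hi $ i}" using s by (simp add: mem_box_cart)
      then have "s $ i \<in> {lo $ i..hi $ i}" using interior_subset by blast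
      with v_own_derivative[OF sX, of i]
      have "((\<lambda>x. v i (deviate s i x)) has_real_derivative own_deriv i (deviate s i (s $ i)))
        (at (s $ i) within {lo $ i..hi $ i})" by blast
      then have deriv: "((\<lambda>x. v i (deviate s i x)) has_real_derivative own_deriv i s) (at (s $ i))"
        unfolding deviate_self at_within_interior[OF si] .
      have mono: "mono_on {lo $ i..hi $ i} (\<lambda>x. v i (deviate s i x))"
        using elim sX strict_mono_on_imp_mono_on by blast
      show "0 \<le> own_deriv i s" by (rule mono_on_imp_deriv_nonneg[OF mono deriv si])
    qed
  qed
  let ?U = "box lo hi \<inter> own_deriv i -` {..<0}"
  have "open ?U"
    using continuous_on_subset[OF own_deriv_continuous, of "box lo hi"] box_subset_cbox[of lo hi]
    by (intro continuous_open_preimage) (auto simp: interval_cbox_cart)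
  moreover have "negligible ?U"
  proof -
    from ae have "AE s in lebesgue. s \<notin> ?U" unfolding AE_completion_iff by eventually_elim auto
    then have "?U \<in> null_sets lebesgue"
      using \<open>open ?U\<close> by (subst (asm) AE_iff_null_sets[symmetric]) (auto simp: null_sets_def)
    then show ?thesis by (simp add: negligible_iff_null_sets)
  qed
  ultimately have "?U = {}" using open_not_negligible by blast
  then have "\<And>s. s \<in> box lo hi \<Longrightarrow> 0 \<le> own_deriv i s" by force
  moreover have "closure (box lo hi) = X"
    using box_nonempty by (simp add: interval_cbox_cart closure_box)
  ultimately show ?thesis
    using continuous_ge_on_closure[of "box lo hi" "own_deriv i" s 0] own_deriv_continuous True by simp
qed (simp add: own_deriv_def)

section \<open>Rents and transfers\<close>

definition rent where
  "rent i \<alpha> s = envelope_rent (\<lambda>x. \<alpha> (deviate s i x)) (\<lambda>x. own_deriv i (deviate s i x)) (lo $ i) (s $ i)"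

text \<open>Each agent keeps exactly the rent, so IR binds at the lowest signal. By
  \<open>feasible_envelope\<close>, feasible transfers for the same allocation can exceed these only
  on a null set.\<close>

definition transfer where
  "transfer \<alpha> s = (\<chi> i. \<alpha> s * v i s - rent i \<alpha> s)"

lemma transfer_nth [simp]: "transfer \<alpha> s $ i = \<alpha> s * v i s - rent i \<alpha> s"
  by (simp add: transfer_def)

lemma alloc_mult_d_measurable:
  assumes "\<alpha> \<in> borel_measurable \<mu>"
  shows "(\<lambda>s. \<alpha> s * own_deriv i s) \<in> borel_measurable borel"
proof -
  note [measurable] = assms[unfolded borel_measurable_\<mu>_iff]
  have "(\<lambda>s. (indicator X s * \<alpha> s) * own_deriv i s) \<in> borel_measurable borel" by measurable
  also have "(\<lambda>s. (indicator X s * \<alpha> s) * own_deriv i s) = (\<lambda>s. \<alpha> s * own_deriv i s)"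
    by (auto simp: own_deriv_def fun_eq_iff indicator_def)
  finally show ?thesis .
qed

lemma own_derivative_continuous:
  "s \<in> X \<Longrightarrow> continuous_on {lo $ i..hi $ i} (\<lambda>x. own_deriv i (deviate s i x))"
  by (intro continuous_on_compose2[OF own_deriv_continuous] continuous_intros) (use deviate_in_box in blast)

lemma own_measurable:
  assumes "\<alpha> \<in> borel_measurable \<mu>"
  shows "(\<lambda>x. \<alpha> (deviate s i x) * own_deriv i (deviate s i x)) \<in> borel_measurable borel"
  by (rule measurable_compose[OF _ alloc_mult_d_measurable[OF assms]]) measurable

lemma rent_measurable:
  assumes "\<alpha> \<in> borel_measurable \<mu>"
  shows "rent i \<alpha> \<in> borel_measurable borel"
proof -
  note [measurable] = alloc_mult_d_measurable[OF assms, of i]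
  \<comment> \<open>The upper limit of integration becomes a factor, so that the integrand is
    jointly measurable in s and y.\<close>
  have "rent i \<alpha> = (\<lambda>s. \<integral>y. of_bool (lo $ i \<le> y \<and> y \<le> s $ i) * (\<lambda>s. \<alpha> s * own_deriv i s) (deviate s i y) \<partial>lborel)"
    by (auto simp: rent_def envelope_rent_def fun_eq_iff indicator_def of_bool_def
        intro!: Bochner_Integration.integral_cong)
  also have "\<dots> \<in> borel_measurable borel" by measurable
  finally show ?thesis .
qed

lemma transfer_measurable:
  assumes "\<alpha> \<in> borel_measurable \<mu>"
  shows "transfer \<alpha> \<in> borel_measurable \<mu>"
proof (subst borel_measurable_euclidean_space, intro ballI)
  fix b :: "real ^ 'n" assume "b \<in> Basis"
  then obtain i where b: "b = axis i 1" by (auto simp: Basis_vec_def)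
  have "rent i \<alpha> \<in> borel_measurable \<mu>"
    using rent_measurable[OF assms] unfolding measurable_cong_sets[OF sets_\<mu> refl]
    by (rule measurable_restrict_space1)
  then have "(\<lambda>s. \<alpha> s * v i s - rent i \<alpha> s) \<in> borel_measurable \<mu>"
    using assms borel_measurable_\<mu>_continuous[OF v_continuous, of i] by measurable
  then show "(\<lambda>s. transfer \<alpha> s \<bullet> b) \<in> borel_measurable \<mu>" by (simp add: b inner_axis)
qed

text \<open>IC is \<open>envelope_rent_subgradient\<close> on the line of agent i through s, and IR
  is nonnegativity of the rent. Both hold at every profile since \<open>own_deriv_nonneg\<close> has
  no exceptional set.\<close>

lemma transfer_IC_IR:
  assumes \<alpha>: "\<alpha> \<in> monotone_allocations \<mu> H"
  shows "ex_post_IC lo hi v \<alpha> (transfer \<alpha>)" "ex_post_IR lo hi v \<alpha> (transfer \<alpha>)"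
proof -
  note A = monotone_allocationsD[OF \<alpha>, unfolded space_\<mu>]
  have a01: "(\<lambda>x. \<alpha> (deviate s i x)) ` {lo $ i..hi $ i} \<subseteq> {0..1}" if "s \<in> X" for s i
    using A(3,4)[OF deviate_in_box[OF that]] by auto
  have nonneg: "\<forall>x\<in>{lo $ i..hi $ i}. 0 \<le> own_deriv i (deviate s i x)" for s i by (simp add: own_deriv_nonneg)
  show "ex_post_IR lo hi v \<alpha> (transfer \<alpha>)"
    unfolding ex_post_IR_def
  proof (intro allI ballI)
    fix i s assume s: "s \<in> X"
    then have "s $ i \<le> hi $ i" by (simp add: less_eq_vec_def)
    then show "0 \<le> \<alpha> s * v i s - transfer \<alpha> s $ i"
      using envelope_rent_nonneg[OF nonneg a01[OF s]] by (simp add: rent_def)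
  qed
  show "ex_post_IC lo hi v \<alpha> (transfer \<alpha>)"
    unfolding ex_post_IC_def
  proof (intro allI ballI)
    fix i s x assume s: "s \<in> X" and x: "x \<in> {lo $ i..hi $ i}"
    have si: "s $ i \<in> {lo $ i..hi $ i}" using s by (simp add: less_eq_vec_def)
    have "rent i \<alpha> (deviate s i x) + \<alpha> (deviate s i x) * (v i s - v i (deviate s i x)) \<le> rent i \<alpha> s"
      using envelope_rent_subgradient[OF v_own_derivative[OF s] own_derivative_continuous[OF s] nonneg
          own_measurable[OF A(1)] mono_on_deviate[OF A(2) s] a01[OF s] si x]
      by (simp add: rent_def)
    then show "\<alpha> (deviate s i x) * v i s - transfer \<alpha> (deviate s i x) $ i \<le> \<alpha> s * v i s - transfer \<alpha> s $ i"
      by (simp add: algebra_simps)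
  qed
qed

text \<open>Along the line, IC says that the utility \<open>u\<close> has subgradient \<alpha> with
  respect to the value. The inequalities of x against y and of y against x add up to a nonnegative
  product of the increments of \<alpha> and of the value, and the latter increases strictly. Then
  \<open>envelope_rent_le\<close> bounds the utility from below by the rent, that is, the transfer
  from above.\<close>

lemma feasible_envelope:
  assumes f: "feasible lo hi g v c \<alpha> t" and s: "s \<in> X"
    and sm: "strict_mono_on {lo $ i..hi $ i} (\<lambda>x. v i (deviate s i x))"
  shows "mono_on {lo $ i..hi $ i} (\<lambda>x. \<alpha> (deviate s i x))"
    and "t s $ i \<le> transfer \<alpha> s $ i"
proof -
  let ?I = "{lo $ i..hi $ i}"
  define u where "u x = \<alpha> (deviate s i x) * v i (deviate s i x) - t (deviate s i x) $ i" for x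
  have sub: "u y + \<alpha> (deviate s i y) * (v i (deviate s i x) - v i (deviate s i y)) \<le> u x"
    if "x \<in> ?I" "y \<in> ?I" for x y
  proof -
    have "deviate s i x \<in> X" using deviate_in_box[OF s that(1)] .
    then have "\<alpha> (deviate (deviate s i x) i y) * v i (deviate s i x) - t (deviate (deviate s i x) i y) $ i \<le> u x"
      using f that(2) unfolding feasible_def ex_post_IC_def u_def by blast
    then show ?thesis by (simp add: u_def algebra_simps)
  qed
  show mono: "mono_on ?I (\<lambda>x. \<alpha> (deviate s i x))"
  proof (rule mono_onI)
    fix x y assume xy: "x \<in> ?I" "y \<in> ?I" "x \<le> y"
    show "\<alpha> (deviate s i x) \<le> \<alpha> (deviate s i y)"
    proof (cases "x = y")
      case False
      then have lt: "v i (deviate s i x) < v i (deviate s i y)"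
        using strict_mono_onD[OF sm] xy by simp
      have "0 \<le> (\<alpha> (deviate s i y) - \<alpha> (deviate s i x)) * (v i (deviate s i y) - v i (deviate s i x))"
        using sub[OF xy(1,2)] sub[OF xy(2,1)] by (simp add: algebra_simps)
      then show ?thesis using lt by (simp add: zero_le_mult_iff)
    qed simp
  qed
  have mech: "\<alpha> \<in> borel_measurable \<mu>" "\<And>s. s \<in> X \<Longrightarrow> 0 \<le> \<alpha> s \<and> \<alpha> s \<le> 1"
    using f unfolding feasible_def mechanism_def measurable_cong_sets[OF sets_\<mu> refl] by auto
  have "envelope_rent (\<lambda>x. \<alpha> (deviate s i x)) (\<lambda>x. own_deriv i (deviate s i x)) (lo $ i) (s $ i) \<le> u (s $ i)"
  proof (rule envelope_rent_le[OF v_own_derivative[OF s] own_derivative_continuous[OF s] _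
        own_measurable[OF mech(1)] mono])
    show "(\<lambda>x. \<alpha> (deviate s i x)) ` ?I \<subseteq> {0..1}" using mech(2)[OF deviate_in_box[OF s]] by auto
    have "deviate s i (lo $ i) \<in> X" using deviate_in_box[OF s] intervals by simp
    then show "0 \<le> u (lo $ i)" using f unfolding feasible_def ex_post_IR_def u_def by blast
    show "s $ i \<in> ?I" using s by (simp add: less_eq_vec_def)
  qed (use sub own_deriv_nonneg in auto)
  then show "t s $ i \<le> transfer \<alpha> s $ i" by (simp add: rent_def u_def)
qed

end

subsection \<open>Reduction to virtual surplus\<close>

context public_good
begin

text \<open>
  The expected rent of agent \<open>i\<close> is linear in the allocation: exchanging the order of
  integration turns it into the mean of \<open>\<alpha>\<close> against the inverse hazard rate
  \<open>upper_tail i / g\<close> times the derivative of the value.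
\<close>

definition upper_tail where
  "upper_tail i s = (\<integral>x. of_bool (s $ i \<le> x) * gX (deviate s i x) \<partial>lborel)"

definition rent_weight where
  "rent_weight i s = own_deriv i s * upper_tail i s / g s"

lemma upper_tail_measurable [measurable]: "upper_tail i \<in> borel_measurable borel"
  unfolding upper_tail_def by measurable

lemma rent_weight_measurable: "rent_weight i \<in> borel_measurable \<mu>"
proof -
  have [measurable]: "g \<in> borel_measurable \<mu>"
    by (rule borel_measurable_\<mu>_continuous[OF g_continuous])
  have [measurable]: "f \<in> borel_measurable \<mu>" if "f \<in> borel_measurable borel" for f :: "real ^ 'n \<Rightarrow> real"
    using that unfolding measurable_cong_sets[OF sets_\<mu> refl] by (rule measurable_restrict_space1)
  show ?thesis unfolding rent_weight_def by measurable
qed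

lemma expected_rent:
  assumes meas: "\<alpha> \<in> borel_measurable \<mu>" and bd: "\<And>s. s \<in> X \<Longrightarrow> 0 \<le> \<alpha> s" "\<And>s. s \<in> X \<Longrightarrow> \<alpha> s \<le> 1"
  shows "integrable \<mu> (rent i \<alpha>)" "integrable \<mu> (\<lambda>s. \<alpha> s * rent_weight i s)"
    "(\<integral>s. rent i \<alpha> s \<partial>\<mu>) = (\<integral>s. \<alpha> s * rent_weight i s \<partial>\<mu>)"
proof -
  define e where "e s = \<alpha> s * own_deriv i s" for s
  have e_meas [measurable]: "e \<in> borel_measurable borel"
    unfolding e_def by (rule alloc_mult_d_measurable[OF meas])
  \<comment> \<open>The integrand of the expected rent with two variables interchanged:
    \<open>s $ i\<close> is the variable of the rent integral and x the true signal. Integrating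
    over x directly gives the weight (\<open>f2\<close>); exchanging coordinates first gives the
    rent (\<open>f1\<close>).\<close>
  define f where "f s x = e s * of_bool (lo $ i \<le> s $ i \<and> s $ i \<le> x) * gX (deviate s i x)" for s x
  have "bounded (own_deriv i ` X)" "bounded (g ` X)"
    by (intro compact_imp_bounded compact_continuous_image own_deriv_continuous g_continuous X_compact)+
  then obtain C C' where C: "\<And>s. s \<in> X \<Longrightarrow> \<bar>own_deriv i s\<bar> \<le> C" and C': "\<And>s. s \<in> X \<Longrightarrow> \<bar>g s\<bar> \<le> C'"
    unfolding bounded_iff by fastforce
  have e_bd: "\<bar>e s\<bar> \<le> C * indicator X s" for s
  proof (cases "s \<in> X")
    case True
    have "\<bar>\<alpha> s\<bar> * \<bar>own_deriv i s\<bar> \<le> 1 * C" using bd[OF True] C[OF True] by (intro mult_mono) auto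
    then show ?thesis using True by (simp add: e_def abs_mult)
  qed (simp add: e_def own_deriv_def)
  have gX_bd: "\<bar>gX s\<bar> \<le> C' * indicator X s" for s
    using C'[of s] by (auto simp: gX_def indicator_def)
  \<comment> \<open>\<open>e\<close> vanishes unless s is in \<open>X\<close>, and \<open>gX\<close>
    unless the deviated profile is; so the integrand is bounded with bounded support, as Fubini
    requires.\<close>
  have f_bd: "norm (f s x) \<le> C * C' * (indicator X s * indicator {lo $ i..hi $ i} x)" for s x
  proof (cases "s \<in> X \<and> deviate s i x \<in> X")
    case True
    then have "deviate s i x $ i \<le> hi $ i" "lo $ i \<le> deviate s i x $ i"
      unfolding atLeastAtMost_iff less_eq_vec_def by blast+
    then have x: "x \<in> {lo $ i..hi $ i}" by simp
    have "norm (f s x) \<le> \<bar>e s\<bar> * \<bar>gX (deviate s i x)\<bar>"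
      unfolding f_def by (simp add: abs_mult)
    also have "\<dots> \<le> C * C'"
      using e_bd[of s] gX_bd[of "deviate s i x"] True by (intro mult_mono) auto
    finally show ?thesis using True x by simp
  next
    case False
    then have "e s = 0 \<or> gX (deviate s i x) = 0" by (auto simp: e_def own_deriv_def gX_def)
    then have "f s x = 0" by (auto simp: f_def)
    moreover have "0 \<le> C * C' * (indicator X s * indicator {lo $ i..hi $ i} x)"
    proof (cases "s \<in> X")
      case True
      then have "0 \<le> C" "0 \<le> C'" using C[OF True] C'[OF True] by auto
      then show ?thesis by simp
    qed simp
    ultimately show ?thesis by simp
  qed
  have "integrable (lborel \<Otimes>\<^sub>M lborel) (\<lambda>p. indicat_real (X \<times> {lo $ i..hi $ i}) p)"
  proof (rule integrable_real_indicator)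
    show "X \<times> {lo $ i..hi $ i} \<in> sets (lborel \<Otimes>\<^sub>M lborel)" by simp
    have "emeasure (lborel \<Otimes>\<^sub>M lborel) (X \<times> {lo $ i..hi $ i}) = emeasure lborel X * emeasure lborel {lo $ i..hi $ i}"
      by (rule lborel.emeasure_pair_measure_Times) simp_all
    also have "\<dots> < \<infinity>"
      using emeasure_lborel_cbox_finite[of lo hi] emeasure_lborel_cbox_finite[of "lo $ i" "hi $ i"]
      by (simp add: interval_cbox_cart ennreal_mult_less_top)
    finally show "emeasure (lborel \<Otimes>\<^sub>M lborel) (X \<times> {lo $ i..hi $ i}) < \<infinity>" .
  qed
  then have "integrable (lborel \<Otimes>\<^sub>M lborel) (\<lambda>p. C * C' * indicat_real (X \<times> {lo $ i..hi $ i}) p)"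
    by (rule integrable_mult_right)
  then have f_int: "integrable (lborel \<Otimes>\<^sub>M lborel) (\<lambda>(s, x). f s x)"
  proof (rule Bochner_Integration.integrable_bound)
    show "(\<lambda>(s, x). f s x) \<in> borel_measurable (lborel \<Otimes>\<^sub>M lborel)" unfolding f_def by measurable
    show "AE p in lborel \<Otimes>\<^sub>M lborel. norm (case p of (s, x) \<Rightarrow> f s x)
        \<le> norm (C * C' * indicat_real (X \<times> {lo $ i..hi $ i}) p)"
    proof (rule AE_I2)
      fix p :: "(real ^ 'n) \<times> real"
      obtain s x where p: "p = (s, x)" by (cases p)
      have "norm (f s x) \<le> C * C' * (indicator X s * indicator {lo $ i..hi $ i} x)" by (rule f_bd)
      also have "\<dots> \<le> \<bar>C * C' * (indicator X s * indicator {lo $ i..hi $ i} x)\<bar>" by (rule abs_ge_self)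
      finally show "norm (case p of (s, x) \<Rightarrow> f s x) \<le> norm (C * C' * indicat_real (X \<times> {lo $ i..hi $ i}) p)"
        by (simp add: p indicator_times)
    qed
  qed
  have f1: "(\<integral>x. f (deviate s i x) (s $ i) \<partial>lborel) = gX s * rent i \<alpha> s" for s
  proof -
    have "f (deviate s i x) (s $ i) = gX s * (indicator {lo $ i..s $ i} x * (\<alpha> (deviate s i x) * own_deriv i (deviate s i x)))" for x
      by (simp add: f_def e_def indicator_def)
    then show ?thesis by (simp add: rent_def envelope_rent_def)
  qed
  have f2: "(\<integral>x. f s x \<partial>lborel) = gX s * (\<alpha> s * rent_weight i s)" for s
  proof (cases "s \<in> X")
    case True
    then have "lo $ i \<le> s $ i" by (simp add: less_eq_vec_def)
    then have "(\<integral>x. f s x \<partial>lborel) = (\<integral>x. e s * (of_bool (s $ i \<le> x) * gX (deviate s i x)) \<partial>lborel)"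
      by (intro Bochner_Integration.integral_cong) (auto simp: f_def)
    also have "\<dots> = e s * upper_tail i s" by (simp add: upper_tail_def)
    also have "\<dots> = gX s * (\<alpha> s * rent_weight i s)"
      using True g_positive[rule_format, OF True] by (simp add: gX_def e_def rent_weight_def)
    finally show ?thesis .
  qed (simp add: f_def e_def own_deriv_def gX_def)
  note ex = integral_exchange_coordinate[OF f_int, of i]
  have rent_meas: "rent i \<alpha> \<in> borel_measurable \<mu>"
    using rent_measurable[OF meas] unfolding measurable_cong_sets[OF sets_\<mu> refl]
    by (rule measurable_restrict_space1)
  have weight_meas: "(\<lambda>s. \<alpha> s * rent_weight i s) \<in> borel_measurable \<mu>"
    using meas rent_weight_measurable by measurable
  show "integrable \<mu> (rent i \<alpha>)"
    unfolding integral_\<mu>(2)[OF rent_meas] f1[symmetric]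
    using lborel_pair.integrable_fst[OF ex(2)] .
  show "integrable \<mu> (\<lambda>s. \<alpha> s * rent_weight i s)"
    unfolding integral_\<mu>(2)[OF weight_meas] f2[symmetric]
    using lborel_pair.integrable_fst[OF f_int] .
  show "(\<integral>s. rent i \<alpha> s \<partial>\<mu>) = (\<integral>s. \<alpha> s * rent_weight i s \<partial>\<mu>)"
    unfolding integral_\<mu>(1)[OF rent_meas] integral_\<mu>(1)[OF weight_meas] f1[symmetric] f2[symmetric]
    by (rule ex(1))
qed

definition surplus where "surplus s = (\<Sum>i\<in>UNIV. v i s) - c"

text \<open>Myerson's virtual surplus. Integrated against \<alpha> it is the expected budget surplus
  of \<open>transfer \<alpha>\<close>.\<close>

definition virtual_surplus where
  "virtual_surplus s = surplus s - (\<Sum>i\<in>UNIV. rent_weight i s)"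

lemma integrable_v: "integrable \<mu> (v i)"
proof -
  have "bounded (v i ` X)" by (intro compact_imp_bounded compact_continuous_image v_continuous X_compact)
  then obtain C where "\<And>s. s \<in> X \<Longrightarrow> \<bar>v i s\<bar> \<le> C" unfolding bounded_iff by fastforce
  then show ?thesis
    by (intro \<mu>.integrable_const_bound[where B=C] borel_measurable_\<mu>_continuous v_continuous) auto
qed

lemma integrable_surplus: "integrable \<mu> surplus"
  unfolding surplus_def using integrable_v by simp

lemma integrable_rent_weight: "integrable \<mu> (rent_weight i)"
  using expected_rent(2)[of "\<lambda>_. 1" i] by simp

lemma integrable_virtual_surplus: "integrable \<mu> virtual_surplus"
  unfolding virtual_surplus_def using integrable_surplus integrable_rent_weight by simp

lemma welfare_eq: "welfare lo hi g v c \<alpha> = (\<integral>s. \<alpha> s * surplus s \<partial>\<mu>)"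
  by (simp add: welfare_def surplus_def)

lemma expected_transfer:
  assumes meas: "\<alpha> \<in> borel_measurable \<mu>" and bd: "\<And>s. s \<in> X \<Longrightarrow> 0 \<le> \<alpha> s" "\<And>s. s \<in> X \<Longrightarrow> \<alpha> s \<le> 1"
  shows "integrable \<mu> (\<lambda>s. transfer \<alpha> s $ i)"
    and "(\<integral>s. (\<Sum>i\<in>UNIV. transfer \<alpha> s $ i) \<partial>\<mu>) - (\<integral>s. c * \<alpha> s \<partial>\<mu>) = (\<integral>s. \<alpha> s * virtual_surplus s \<partial>\<mu>)"
proof -
  note R = expected_rent[OF meas bd]
  have av: "integrable \<mu> (\<lambda>s. \<alpha> s * v i s)" for i
    by (rule integrable_allocation_mult[OF meas integrable_v]) (use bd in auto)
  have a1: "integrable \<mu> (\<lambda>s. c * \<alpha> s)"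
    using integrable_allocation_mult[OF meas, of "\<lambda>_. c"] bd by (simp add: mult.commute)
  show "integrable \<mu> (\<lambda>s. transfer \<alpha> s $ i)" for i
    using av R(1) by simp
  have "(\<integral>s. (\<Sum>i\<in>UNIV. transfer \<alpha> s $ i) \<partial>\<mu>) - (\<integral>s. c * \<alpha> s \<partial>\<mu>)
      = (\<Sum>i\<in>UNIV. (\<integral>s. \<alpha> s * v i s \<partial>\<mu>) - (\<integral>s. \<alpha> s * rent_weight i s \<partial>\<mu>)) - (\<integral>s. c * \<alpha> s \<partial>\<mu>)"
    using av R by simp
  also have "\<dots> = (\<integral>s. (\<Sum>i\<in>UNIV. \<alpha> s * v i s - \<alpha> s * rent_weight i s) - c * \<alpha> s \<partial>\<mu>)"
    using av R a1 by simp
  also have "\<dots> = (\<integral>s. \<alpha> s * virtual_surplus s \<partial>\<mu>)"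
    by (simp add: virtual_surplus_def surplus_def sum_subtractf sum_distrib_left algebra_simps)
  finally show "(\<integral>s. (\<Sum>i\<in>UNIV. transfer \<alpha> s $ i) \<partial>\<mu>) - (\<integral>s. c * \<alpha> s \<partial>\<mu>) = (\<integral>s. \<alpha> s * virtual_surplus s \<partial>\<mu>)" .
qed

section \<open>Feasibility as one linear inequality\<close>

lemma mechanism_iff:
  "mechanism lo hi \<alpha> t \<longleftrightarrow> \<alpha> \<in> borel_measurable \<mu> \<and> t \<in> borel_measurable \<mu> \<and>
     (\<forall>s\<in>X. 0 \<le> \<alpha> s \<and> \<alpha> s \<le> 1)"
  unfolding mechanism_def measurable_cong_sets[OF sets_\<mu> refl] ..

lemma feasible_transfer:
  assumes \<alpha>: "\<alpha> \<in> monotone_allocations \<mu> H" and "0 \<le> (\<integral>s. \<alpha> s * virtual_surplus s \<partial>\<mu>)"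
  shows "feasible lo hi g v c \<alpha> (transfer \<alpha>)"
proof -
  note A = monotone_allocationsD[OF \<alpha>, unfolded space_\<mu>]
  show ?thesis
    unfolding feasible_def mechanism_iff budget_balanced_def
    using transfer_IC_IR[OF \<alpha>] transfer_measurable[OF A(1)] expected_transfer[OF A(1,3,4)] A assms(2)
    by auto
qed

text \<open>Almost everywhere each transfer is at most the envelope transfer, so budget balance of
  \<open>t\<close> passes to \<open>transfer \<alpha>\<close>. For monotone allocations
  \<open>feasible_transfer\<close> is the converse.\<close>

lemma feasible_virtual_surplus:
  assumes f: "feasible lo hi g v c \<alpha> t"
  shows "0 \<le> (\<integral>s. \<alpha> s * virtual_surplus s \<partial>\<mu>)"
proof -
  have mech: "\<alpha> \<in> borel_measurable \<mu>" "\<And>s. s \<in> X \<Longrightarrow> 0 \<le> \<alpha> s" "\<And>s. s \<in> X \<Longrightarrow> \<alpha> s \<le> 1"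
    using f unfolding feasible_def mechanism_iff by auto
  have ae: "AE s in \<mu>. t s $ i \<le> transfer \<alpha> s $ i" for i
    unfolding AE_\<mu> using AE_strict_mono[of i]
    by eventually_elim (use feasible_envelope(2)[OF f] in blast)
  have "AE s in \<mu>. \<forall>i\<in>UNIV. t s $ i \<le> transfer \<alpha> s $ i"
    by (rule AE_finite_allI) (use ae in auto)
  then have "AE s in \<mu>. (\<Sum>i\<in>UNIV. t s $ i) \<le> (\<Sum>i\<in>UNIV. transfer \<alpha> s $ i)"
    by eventually_elim (rule sum_mono, blast)
  then have "(\<integral>s. (\<Sum>i\<in>UNIV. t s $ i) \<partial>\<mu>) \<le> (\<integral>s. (\<Sum>i\<in>UNIV. transfer \<alpha> s $ i) \<partial>\<mu>)"
    using f unfolding feasible_def budget_balanced_def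
    by (intro integral_mono_AE) (auto simp del: transfer_nth intro!: Bochner_Integration.integrable_sum expected_transfer(1)[OF mech])
  moreover have "(\<integral>s. c * \<alpha> s \<partial>\<mu>) \<le> (\<integral>s. (\<Sum>i\<in>UNIV. t s $ i) \<partial>\<mu>)"
    using f unfolding feasible_def budget_balanced_def by blast
  ultimately show ?thesis using expected_transfer(2)[OF mech] by linarith
qed

text \<open>The constraints force \<alpha> to be monotone only along almost all lines. Its monotone
  version \<beta> has the same integrals against every integrable weight; the transfers
  \<open>t\<close> are not carried over, since \<open>feasible_transfer\<close> supplies new
  ones.\<close>

lemma feasible_monotone_allocation:
  assumes f: "feasible lo hi g v c \<alpha> t"
  obtains \<beta> where "\<beta> \<in> monotone_allocations \<mu> {}" "0 \<le> (\<integral>s. \<beta> s * virtual_surplus s \<partial>\<mu>)"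
    "welfare lo hi g v c \<beta> = welfare lo hi g v c \<alpha>"
proof -
  have mech: "\<alpha> \<in> borel_measurable \<mu>" "\<And>s. s \<in> X \<Longrightarrow> 0 \<le> \<alpha> s" "\<And>s. s \<in> X \<Longrightarrow> \<alpha> s \<le> 1"
    using f unfolding feasible_def mechanism_iff by auto
  define \<alpha>' where "\<alpha>' s = indicator X s * \<alpha> s" for s
  have \<alpha>'_eq: "\<alpha>' s = \<alpha> s" if "s \<in> X" for s using that by (simp add: \<alpha>'_def)
  have meas': "\<alpha>' \<in> borel_measurable borel"
    using mech(1) unfolding borel_measurable_\<mu>_iff \<alpha>'_def .
  have 01: "\<alpha>' ` X \<subseteq> {0..1}" using mech by (auto simp: \<alpha>'_def)
  have mono': "AE s in lborel. s \<in> X \<longrightarrow> mono_on {lo $ i..hi $ i} (\<lambda>x. \<alpha>' (deviate s i x))" for i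
    using AE_strict_mono[of i]
  proof eventually_elim
    case (elim s)
    show ?case
    proof
      assume s: "s \<in> X"
      from feasible_envelope(1)[OF f s] elim s
      have "mono_on {lo $ i..hi $ i} (\<lambda>x. \<alpha> (deviate s i x))" by blast
      then show "mono_on {lo $ i..hi $ i} (\<lambda>x. \<alpha>' (deviate s i x))"
        using deviate_in_box[OF s] by (simp add: mono_on_def \<alpha>'_eq)
    qed
  qed
  obtain \<beta> where \<beta>: "\<beta> \<in> monotone_allocations borel {}" and eq: "AE s in lborel. s \<in> X \<longrightarrow> \<beta> s = \<alpha>' s"
    by (rule monotone_version[OF meas' 01 mono'])
  note B = monotone_allocationsD[OF \<beta>]
  have \<beta>\<mu>: "\<beta> \<in> monotone_allocations \<mu> {}"
  proof (rule monotone_allocationsI)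
    show "\<beta> \<in> borel_measurable \<mu>"
      using B(1) unfolding measurable_cong_sets[OF sets_\<mu> refl] by (rule measurable_restrict_space1)
    show "mono_on (space \<mu>) \<beta>" using B(2) by (rule mono_on_subset) simp
  qed (use B(3,4) in auto)
  have same: "(\<integral>s. \<beta> s * w s \<partial>\<mu>) = (\<integral>s. \<alpha> s * w s \<partial>\<mu>)" if "integrable \<mu> w" for w
  proof -
    note [measurable] = mech(1) monotone_allocationsD(1)[OF \<beta>\<mu>] borel_measurable_integrable[OF that]
    have "AE s in \<mu>. \<beta> s * w s = \<alpha> s * w s"
      unfolding AE_\<mu> using eq by eventually_elim (simp add: \<alpha>'_eq)
    then show ?thesis by (intro integral_cong_AE) measurable
  qed
  show thesis
    using that[OF \<beta>\<mu>] feasible_virtual_surplus[OF f]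
    by (simp add: welfare_eq same integrable_surplus integrable_virtual_surplus)
qed

section \<open>Optimal two-threshold policies\<close>

text \<open>The two-level improvement of a maximizer stays in the class with invariance
  \<open>H\<close>, so it is a maximizer too.\<close>

lemma exists_best_two_threshold:
  obtains \<alpha> where "\<alpha> \<in> monotone_allocations \<mu> H" "two_threshold lo hi \<alpha>"
    "0 \<le> (\<integral>s. \<alpha> s * virtual_surplus s \<partial>\<mu>)"
    "\<forall>\<beta>\<in>monotone_allocations \<mu> H. 0 \<le> (\<integral>s. \<beta> s * virtual_surplus s \<partial>\<mu>) \<longrightarrow>
       welfare lo hi g v c \<beta> \<le> welfare lo hi g v c \<alpha>"
proof -
  obtain \<alpha> where \<alpha>: "\<alpha> \<in> monotone_allocations \<mu> H" "0 \<le> (\<integral>s. \<alpha> s * virtual_surplus s \<partial>\<mu>)"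
    and best: "\<forall>\<beta>\<in>monotone_allocations \<mu> H. 0 \<le> (\<integral>s. \<beta> s * virtual_surplus s \<partial>\<mu>) \<longrightarrow>
       (\<integral>s. \<beta> s * surplus s \<partial>\<mu>) \<le> (\<integral>s. \<alpha> s * surplus s \<partial>\<mu>)"
    by (rule exists_optimal_allocation[where G=H, OF g_density integrable_surplus integrable_virtual_surplus])
  obtain \<gamma> p where \<gamma>: "\<gamma> \<in> monotone_allocations \<mu> H" "0 \<le> (\<integral>s. \<gamma> s * virtual_surplus s \<partial>\<mu>)"
    "(\<integral>s. \<alpha> s * surplus s \<partial>\<mu>) \<le> (\<integral>s. \<gamma> s * surplus s \<partial>\<mu>)"
    "0 \<le> p" "p \<le> 1" "\<forall>s. \<gamma> s \<in> {0, p, 1}"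
    by (rule exists_two_level_improvement[OF g_density integrable_surplus integrable_virtual_surplus \<alpha>])
  show thesis
  proof
    show "two_threshold lo hi \<gamma>"
      using monotone_allocationsD(2)[OF \<gamma>(1)] \<gamma>(4-6) by (intro two_threshold_if_two_levels) auto
    show "\<forall>\<beta>\<in>monotone_allocations \<mu> H. 0 \<le> (\<integral>s. \<beta> s * virtual_surplus s \<partial>\<mu>) \<longrightarrow>
       welfare lo hi g v c \<beta> \<le> welfare lo hi g v c \<gamma>"
      using best \<gamma>(3) unfolding welfare_eq by (meson order_trans)
  qed (use \<gamma> in auto)
qed

lemma exists_optimal_two_threshold:
  "\<exists>\<alpha> t. optimal lo hi g v c \<alpha> t \<and> two_threshold lo hi \<alpha>"
proof -
  obtain \<alpha> where \<alpha>: "\<alpha> \<in> monotone_allocations \<mu> {}" "two_threshold lo hi \<alpha>"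
    "0 \<le> (\<integral>s. \<alpha> s * virtual_surplus s \<partial>\<mu>)"
    and best: "\<forall>\<beta>\<in>monotone_allocations \<mu> {}. 0 \<le> (\<integral>s. \<beta> s * virtual_surplus s \<partial>\<mu>) \<longrightarrow>
       welfare lo hi g v c \<beta> \<le> welfare lo hi g v c \<alpha>"
    by (rule exists_best_two_threshold[where H="{}"])
  have "welfare lo hi g v c \<beta> \<le> welfare lo hi g v c \<alpha>" if f: "feasible lo hi g v c \<beta> t" for \<beta> t
  proof -
    obtain \<gamma> where "\<gamma> \<in> monotone_allocations \<mu> {}" "0 \<le> (\<integral>s. \<gamma> s * virtual_surplus s \<partial>\<mu>)"
      "welfare lo hi g v c \<gamma> = welfare lo hi g v c \<beta>"
      by (rule feasible_monotone_allocation[OF f])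
    with best show ?thesis by metis
  qed
  then have "optimal lo hi g v c \<alpha> (transfer \<alpha>)"
    unfolding optimal_def using feasible_transfer[OF \<alpha>(1,3)] by blast
  then show ?thesis using \<alpha>(2) by blast
qed

end

subsection \<open>Symmetric agents\<close>

definition permutation_maps :: "(real ^ 'n \<Rightarrow> real ^ 'n) set" where
  "permutation_maps = permute_profile ` {\<pi>. \<pi> permutes UNIV}"

lemma permute_profile_nth [simp]: "permute_profile \<pi> s $ i = s $ \<pi> i"
  by (simp add: permute_profile_def)

lemma permute_profile_compose: "permute_profile \<pi> (permute_profile \<sigma> s) = permute_profile (\<sigma> \<circ> \<pi>) s"
  by (simp add: vec_eq_iff)

lemma permute_profile_mono: "r \<le> s \<Longrightarrow> permute_profile \<pi> r \<le> permute_profile \<pi> s"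
  by (simp add: less_eq_vec_def)

lemma permute_profile_deviate:
  assumes "\<pi> permutes UNIV"
  shows "permute_profile \<pi> (deviate s (\<pi> i) x) = deviate (permute_profile \<pi> s) i x"
  using permutes_inj[OF assms] by (auto simp: vec_eq_iff dest: injD)

lemma permute_profile_measurable [measurable]: "permute_profile \<pi> \<in> borel_measurable borel"
proof (rule borel_measurable_continuous_onI)
  show "continuous_on UNIV (permute_profile \<pi>)"
    unfolding permute_profile_def by (intro continuous_intros)
qed

context public_good
begin

context
  assumes sym: "symmetric_agents lo hi v" and exch: "exchangeable lo hi g"
begin

lemma bounds_equal: "lo $ i = lo $ j" "hi $ i = hi $ j"
proof -
  have "{lo $ i..hi $ i} = {lo $ j..hi $ j}" using sym by (simp add: symmetric_agents_def)
  then show "lo $ i = lo $ j" "hi $ i = hi $ j" using intervals by (auto simp: Icc_eq_Icc)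
qed

lemma permute_profile_in_X: "s \<in> X \<Longrightarrow> permute_profile \<pi> s \<in> X"
  unfolding atLeastAtMost_iff less_eq_vec_def permute_profile_nth using bounds_equal by metis

lemma v_permute: "\<pi> permutes UNIV \<Longrightarrow> s \<in> X \<Longrightarrow> v i (permute_profile \<pi> s) = v (\<pi> i) s"
  using sym by (simp add: symmetric_agents_def)

lemma permute_profile_measurable_\<mu>: "permute_profile \<pi> \<in> \<mu> \<rightarrow>\<^sub>M \<mu>"
proof -
  have "permute_profile \<pi> \<in> restrict_space borel X \<rightarrow>\<^sub>M restrict_space borel X"
    by (rule measurable_restrict_space3[OF permute_profile_measurable]) (use permute_profile_in_X in auto)
  then show ?thesis unfolding measurable_cong_sets[OF sets_\<mu> sets_\<mu>] .
qed

lemma integral_permute: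
  fixes f :: "real ^ 'n \<Rightarrow> real"
  assumes f: "f \<in> borel_measurable \<mu>" and \<pi>: "\<pi> permutes UNIV"
  shows "(\<integral>s. f (permute_profile \<pi> s) \<partial>\<mu>) = (\<integral>s. f s \<partial>\<mu>)"
    and "integrable \<mu> (\<lambda>s. f (permute_profile \<pi> s)) \<longleftrightarrow> integrable \<mu> f"
proof -
  \<comment> \<open>Exchangeability compares distributions on \<open>borel\<close>, hence the
    extension by zero.\<close>
  define f' where "f' s = indicator X s * f s" for s
  have f' [measurable]: "f' \<in> borel_measurable borel" using f unfolding borel_measurable_\<mu>_iff f'_def .
  have eq: "f' s = f s" "f' (permute_profile \<pi> s) = f (permute_profile \<pi> s)" if "s \<in> X" for s
    using that permute_profile_in_X by (simp_all add: f'_def)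
  have id: "(\<lambda>s. s) \<in> \<mu> \<rightarrow>\<^sub>M borel" and perm: "permute_profile \<pi> \<in> \<mu> \<rightarrow>\<^sub>M borel"
    unfolding measurable_cong_sets[OF sets_\<mu> refl] by (intro measurable_restrict_space1; measurable)+
  have D: "distr \<mu> borel (permute_profile \<pi>) = distr \<mu> borel (\<lambda>s. s)"
    using exch \<pi> unfolding exchangeable_def by blast
  have "(\<integral>s. f (permute_profile \<pi> s) \<partial>\<mu>) = (\<integral>s. f' (permute_profile \<pi> s) \<partial>\<mu>)"
    by (rule Bochner_Integration.integral_cong) (simp_all add: eq)
  also have "\<dots> = (\<integral>s. f' s \<partial>distr \<mu> borel (permute_profile \<pi>))" by (rule integral_distr[OF perm f', symmetric])
  also have "\<dots> = (\<integral>s. f' s \<partial>\<mu>)" unfolding D by (rule integral_distr[OF id f'])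
  also have "\<dots> = (\<integral>s. f s \<partial>\<mu>)" by (rule Bochner_Integration.integral_cong) (simp_all add: eq)
  finally show "(\<integral>s. f (permute_profile \<pi> s) \<partial>\<mu>) = (\<integral>s. f s \<partial>\<mu>)" .
  have "integrable \<mu> (\<lambda>s. f (permute_profile \<pi> s)) \<longleftrightarrow> integrable \<mu> (\<lambda>s. f' (permute_profile \<pi> s))"
    by (rule Bochner_Integration.integrable_cong) (simp_all add: eq)
  also have "\<dots> \<longleftrightarrow> integrable (distr \<mu> borel (permute_profile \<pi>)) f'" by (rule integrable_distr_eq[OF perm f', symmetric])
  also have "\<dots> \<longleftrightarrow> integrable \<mu> f'" unfolding D by (rule integrable_distr_eq[OF id f'])
  also have "\<dots> \<longleftrightarrow> integrable \<mu> f" by (rule Bochner_Integration.integrable_cong) (simp_all add: eq)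
  finally show "integrable \<mu> (\<lambda>s. f (permute_profile \<pi> s)) \<longleftrightarrow> integrable \<mu> f" .
qed

text \<open>Agent j takes the role that \<open>inv \<pi> j\<close> has in the original mechanism at
  the permuted profile. By symmetry both have the same value there, so IC and IR carry over, and
  exchangeability preserves the expected budget.\<close>

lemma feasible_permute:
  assumes \<pi>: "\<pi> permutes UNIV" and f: "feasible lo hi g v c \<alpha> t"
  shows "feasible lo hi g v c (\<lambda>s. \<alpha> (permute_profile \<pi> s)) (\<lambda>s. \<chi> j. t (permute_profile \<pi> s) $ inv \<pi> j)"
    (is "feasible lo hi g v c ?\<alpha> ?t")
proof -
  have mech: "\<alpha> \<in> borel_measurable \<mu>" "t \<in> borel_measurable \<mu>" "\<And>s. s \<in> X \<Longrightarrow> 0 \<le> \<alpha> s \<and> \<alpha> s \<le> 1"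
    using f unfolding feasible_def mechanism_iff by auto
  have inv: "\<pi> (inv \<pi> j) = j" for j using permutes_inverses[OF \<pi>] by simp
  have dev: "permute_profile \<pi> (deviate s j x) = deviate (permute_profile \<pi> s) (inv \<pi> j) x" for s j x
    using permute_profile_deviate[OF \<pi>, of s "inv \<pi> j" x] by (simp add: inv)
  have val: "v j s = v (inv \<pi> j) (permute_profile \<pi> s)" if "s \<in> X" for j s
    using v_permute[OF \<pi> that] by (simp add: inv)
  have sum: "(\<Sum>j\<in>UNIV. ?t s $ j) = (\<Sum>i\<in>UNIV. t (permute_profile \<pi> s) $ i)" for s
    using sum.permute[OF permutes_inv[OF \<pi>], of "\<lambda>i. t (permute_profile \<pi> s) $ i"] by (simp add: o_def)
  have t_meas: "?t \<in> borel_measurable \<mu>"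
  proof (subst borel_measurable_euclidean_space, intro ballI)
    fix b :: "real ^ 'n" assume "b \<in> Basis"
    then obtain i where b: "b = axis i 1" by (auto simp: Basis_vec_def)
    have "(\<lambda>s. t s $ inv \<pi> i) \<in> borel_measurable \<mu>" by (rule measurable_vec_nth[OF mech(2)])
    from measurable_compose[OF permute_profile_measurable_\<mu> this]
    show "(\<lambda>s. ?t s \<bullet> b) \<in> borel_measurable \<mu>" by (simp add: b inner_axis)
  qed
  have "mechanism lo hi ?\<alpha> ?t"
    unfolding mechanism_iff
    using measurable_compose[OF permute_profile_measurable_\<mu> mech(1)] t_meas mech(3)[OF permute_profile_in_X]
    by blast
  moreover have "budget_balanced lo hi g c ?\<alpha> ?t"
  proof -
    have m1: "(\<lambda>s. \<Sum>i\<in>UNIV. t s $ i) \<in> borel_measurable \<mu>"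
      by (intro borel_measurable_sum measurable_vec_nth mech(2))
    show ?thesis
      using f integral_permute[OF m1 \<pi>] integral_permute(1)[OF mech(1) \<pi>]
      unfolding feasible_def budget_balanced_def sum by simp
  qed
  moreover have "ex_post_IC lo hi v ?\<alpha> ?t"
    unfolding ex_post_IC_def
  proof (intro allI ballI)
    fix j s x assume s: "s \<in> X" and x: "x \<in> {lo $ j..hi $ j}"
    have "x \<in> {lo $ inv \<pi> j..hi $ inv \<pi> j}" using x bounds_equal[of j "inv \<pi> j"] by simp
    with f permute_profile_in_X[OF s, of \<pi>]
    have "\<alpha> (deviate (permute_profile \<pi> s) (inv \<pi> j) x) * v (inv \<pi> j) (permute_profile \<pi> s)
          - t (deviate (permute_profile \<pi> s) (inv \<pi> j) x) $ inv \<pi> j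
        \<le> \<alpha> (permute_profile \<pi> s) * v (inv \<pi> j) (permute_profile \<pi> s) - t (permute_profile \<pi> s) $ inv \<pi> j"
      unfolding feasible_def ex_post_IC_def by blast
    then show "?\<alpha> (deviate s j x) * v j s - ?t (deviate s j x) $ j \<le> ?\<alpha> s * v j s - ?t s $ j"
      using val[OF s, of j] by (simp add: dev)
  qed
  moreover have "ex_post_IR lo hi v ?\<alpha> ?t"
    unfolding ex_post_IR_def
  proof (intro allI ballI)
    fix j s assume s: "s \<in> X"
    with f permute_profile_in_X[OF s, of \<pi>]
    have "0 \<le> \<alpha> (permute_profile \<pi> s) * v (inv \<pi> j) (permute_profile \<pi> s) - t (permute_profile \<pi> s) $ inv \<pi> j"
      unfolding feasible_def ex_post_IR_def by blast
    then show "0 \<le> ?\<alpha> s * v j s - ?t s $ j" using val[OF s, of j] by simp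
  qed
  ultimately show ?thesis unfolding feasible_def by blast
qed

lemma surplus_permute: "\<pi> permutes UNIV \<Longrightarrow> s \<in> X \<Longrightarrow> surplus (permute_profile \<pi> s) = surplus s"
  using sum.permute[of \<pi> UNIV "\<lambda>i. v i s"] by (simp add: surplus_def v_permute o_def)

text \<open>The average over all permutations works because both functionals are linear and each
  permuted copy keeps the welfare and satisfies the budget inequality. The latter is inferred from
  feasibility of the permuted mechanism, which avoids computing how \<open>rent_weight\<close>
  transforms under permutations.\<close>

lemma exists_symmetric_version:
  assumes \<beta>: "\<beta> \<in> monotone_allocations \<mu> {}" and nonneg: "0 \<le> (\<integral>s. \<beta> s * virtual_surplus s \<partial>\<mu>)"
  obtains \<gamma> where "\<gamma> \<in> monotone_allocations \<mu> permutation_maps"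
    "0 \<le> (\<integral>s. \<gamma> s * virtual_surplus s \<partial>\<mu>)" "welfare lo hi g v c \<gamma> = welfare lo hi g v c \<beta>"
proof -
  note B = monotone_allocationsD[OF \<beta>, unfolded space_\<mu>]
  define Pi where "Pi = {\<pi> :: 'n \<Rightarrow> 'n. \<pi> permutes UNIV}"
  have fin: "finite Pi" unfolding Pi_def by (rule finite_permutations) simp
  have "id \<in> Pi" by (simp add: Pi_def permutes_id)
  then have card: "0 < real (card Pi)" using fin by (auto simp: card_gt_0_iff)
  define \<gamma> where "\<gamma> s = (\<Sum>\<pi>\<in>Pi. \<beta> (permute_profile \<pi> s)) / card Pi" for s
  have perm_meas: "(\<lambda>s. \<beta> (permute_profile \<pi> s)) \<in> borel_measurable \<mu>" for \<pi>
    by (rule measurable_compose[OF permute_profile_measurable_\<mu> B(1)])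
  have int: "integrable \<mu> (\<lambda>s. \<beta> (permute_profile \<pi> s) * w s)" if "integrable \<mu> w" for \<pi> w
    by (rule integrable_allocation_mult[OF perm_meas that]) (use B(3,4) permute_profile_in_X in auto)
  have avg: "(\<integral>s. \<gamma> s * w s \<partial>\<mu>) = (\<Sum>\<pi>\<in>Pi. \<integral>s. \<beta> (permute_profile \<pi> s) * w s \<partial>\<mu>) / card Pi"
    if "integrable \<mu> w" for w
    using int[OF that] by (simp add: \<gamma>_def sum_distrib_right)
  show thesis
  proof
    show "\<gamma> \<in> monotone_allocations \<mu> permutation_maps"
    proof (rule monotone_allocationsI)
      show "\<gamma> \<in> borel_measurable \<mu>" unfolding \<gamma>_def using perm_meas by simp
      show "mono_on (space \<mu>) \<gamma>"
        unfolding \<gamma>_def space_\<mu>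
        by (intro mono_onI divide_right_mono sum_mono mono_onD[OF B(2)] permute_profile_in_X permute_profile_mono) auto
      fix s assume "s \<in> space \<mu>"
      then have s: "permute_profile \<pi> s \<in> X" for \<pi> using permute_profile_in_X by simp
      show "0 \<le> \<gamma> s" unfolding \<gamma>_def using B(3)[OF s] by (intro divide_nonneg_nonneg sum_nonneg) auto
      have "(\<Sum>\<pi>\<in>Pi. \<beta> (permute_profile \<pi> s)) \<le> (\<Sum>\<pi>\<in>Pi. 1)" using B(4)[OF s] by (intro sum_mono) auto
      then show "\<gamma> s \<le> 1" unfolding \<gamma>_def using card by (simp add: divide_le_eq_1)
      fix T :: "real ^ 'n \<Rightarrow> real ^ 'n" assume "T \<in> permutation_maps"
      then obtain \<sigma> where \<sigma>: "\<sigma> permutes UNIV" "T = permute_profile \<sigma>" by (auto simp: permutation_maps_def)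
      have "(\<Sum>\<pi>\<in>Pi. \<beta> (permute_profile \<pi> (T s))) = (\<Sum>\<pi>\<in>Pi. \<beta> (permute_profile (\<sigma> \<circ> \<pi>) s))"
        by (simp add: \<sigma>(2) permute_profile_compose)
      also have "\<dots> = (\<Sum>\<pi>\<in>Pi. \<beta> (permute_profile \<pi> s))"
        unfolding Pi_def by (rule setum_permutations_compose_left[OF \<sigma>(1), symmetric])
      finally show "\<gamma> (T s) = \<gamma> s" by (simp add: \<gamma>_def)
    qed
    have "0 \<le> (\<integral>s. \<beta> (permute_profile \<pi> s) * virtual_surplus s \<partial>\<mu>)" if "\<pi> \<in> Pi" for \<pi>
      using feasible_virtual_surplus[OF feasible_permute[OF _ feasible_transfer[OF \<beta> nonneg]]] that
      by (simp add: Pi_def)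
    then show "0 \<le> (\<integral>s. \<gamma> s * virtual_surplus s \<partial>\<mu>)"
      unfolding avg[OF integrable_virtual_surplus] by (intro divide_nonneg_nonneg sum_nonneg) auto
    have "(\<integral>s. \<beta> (permute_profile \<pi> s) * surplus s \<partial>\<mu>) = (\<integral>s. \<beta> s * surplus s \<partial>\<mu>)" if "\<pi> \<in> Pi" for \<pi>
    proof -
      have \<pi>: "\<pi> permutes UNIV" using that by (simp add: Pi_def)
      have "(\<integral>s. \<beta> (permute_profile \<pi> s) * surplus s \<partial>\<mu>)
          = (\<integral>s. \<beta> (permute_profile \<pi> s) * surplus (permute_profile \<pi> s) \<partial>\<mu>)"
        by (rule Bochner_Integration.integral_cong) (simp_all add: surplus_permute[OF \<pi>])
      also have "\<dots> = (\<integral>s. \<beta> s * surplus s \<partial>\<mu>)"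
        by (rule integral_permute(1)[OF borel_measurable_times[OF B(1)
              borel_measurable_integrable[OF integrable_surplus]] \<pi>])
      finally show ?thesis .
    qed
    then show "welfare lo hi g v c \<gamma> = welfare lo hi g v c \<beta>"
      unfolding welfare_eq avg[OF integrable_surplus] using card by (cases "Pi = {}") simp_all
  qed
qed

lemma exists_optimal_symmetric_two_threshold:
  "\<exists>\<alpha> t. optimal lo hi g v c \<alpha> t \<and> two_threshold lo hi \<alpha> \<and> symmetric_allocation lo hi \<alpha>"
proof -
  obtain \<alpha> where \<alpha>: "\<alpha> \<in> monotone_allocations \<mu> permutation_maps" "two_threshold lo hi \<alpha>"
    "0 \<le> (\<integral>s. \<alpha> s * virtual_surplus s \<partial>\<mu>)"
    and best: "\<forall>\<beta>\<in>monotone_allocations \<mu> permutation_maps. 0 \<le> (\<integral>s. \<beta> s * virtual_surplus s \<partial>\<mu>) \<longrightarrow>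
       welfare lo hi g v c \<beta> \<le> welfare lo hi g v c \<alpha>"
    by (rule exists_best_two_threshold[where H=permutation_maps])
  have "welfare lo hi g v c \<beta> \<le> welfare lo hi g v c \<alpha>" if f: "feasible lo hi g v c \<beta> t" for \<beta> t
  proof -
    obtain \<gamma> where \<gamma>: "\<gamma> \<in> monotone_allocations \<mu> {}" "0 \<le> (\<integral>s. \<gamma> s * virtual_surplus s \<partial>\<mu>)"
      "welfare lo hi g v c \<gamma> = welfare lo hi g v c \<beta>"
      by (rule feasible_monotone_allocation[OF f])
    obtain \<delta> where "\<delta> \<in> monotone_allocations \<mu> permutation_maps"
      "0 \<le> (\<integral>s. \<delta> s * virtual_surplus s \<partial>\<mu>)" "welfare lo hi g v c \<delta> = welfare lo hi g v c \<gamma>"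
      by (rule exists_symmetric_version[OF \<gamma>(1,2)])
    with best \<gamma>(3) show ?thesis by metis
  qed
  then have "optimal lo hi g v c \<alpha> (transfer \<alpha>)"
    unfolding optimal_def using feasible_transfer[OF \<alpha>(1,3)] by blast
  moreover have "symmetric_allocation lo hi \<alpha>"
    unfolding symmetric_allocation_def
    using monotone_allocationsD(5)[OF \<alpha>(1)] by (auto simp: permutation_maps_def)
  ultimately show ?thesis using \<alpha>(2) by blast
qed

end

end

theorem proposition8:
  fixes lo hi :: "real ^ 'n::finite"
    and g :: "real ^ 'n \<Rightarrow> real"
    and v :: "'n \<Rightarrow> real ^ 'n \<Rightarrow> real"
    and c :: real
  assumes intervals: "\<forall>i. lo $ i \<le> hi $ i"
    and g_continuous: "continuous_on {lo..hi} g"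
    and g_positive: "\<forall>s\<in>{lo..hi}. g s > 0"
    and g_density: "prob_space (signal_dist lo hi g)"
    and v_bounded: "\<forall>i. bounded (v i ` {lo..hi})"
    and v_C1: "\<forall>i. C1_on {lo..hi} (v i)"
    and v_increasing: "increasing_in_own_signal lo hi g v"
  shows "(\<exists>\<alpha> t. optimal lo hi g v c \<alpha> t \<and> two_threshold lo hi \<alpha>) \<and>
    (symmetric_agents lo hi v \<and> exchangeable lo hi g \<longrightarrow>
       (\<exists>\<alpha> t. optimal lo hi g v c \<alpha> t \<and> two_threshold lo hi \<alpha> \<and> symmetric_allocation lo hi \<alpha>))"
proof -
  interpret public_good lo hi g v c
    by (rule public_good.intro[OF assms(1-4,6,7)])
  show ?thesis
  proof (intro conjI impI exists_optimal_two_threshold)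
    assume "symmetric_agents lo hi v \<and> exchangeable lo hi g"
    then show "\<exists>\<alpha> t. optimal lo hi g v c \<alpha> t \<and> two_threshold lo hi \<alpha> \<and> symmetric_allocation lo hi \<alpha>"
      by (elim conjE) (rule exists_optimal_symmetric_two_threshold)
  qed
qed

end
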